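(* Let $A$ be a finite involutively closed alphabet and let $\Gamma^{(1)},\ldots,\Gamma^{(k)}$ be $A$-graphs that are context-free and complete. Then the transition group $\mathcal{G}(\Gamma^{(1)}\sqcup\cdots\sqcup\Gamma^{(k)})$ is co-context-free; that is, the complement in $A^*$ of its word problem with respect to $A$ is a context-free language.
   Context: Let $A$ be a finite alphabet closed under a formal inversion $a\mapsto a^{-1}$ ($a^{-1}\ne a$, $(a^{-1})^{-1}=a$), $A^*$ the free monoid on $A$, and $F_A$ the free group whose elements are the reduced words over $A$ (the letter $a^{-1}$ being the inverse of $a$). An $A$-graph (also called inverse $A$-digraph) is a connected directed graph $\Gamma$ with vertex set $V(\Gamma)$, edges labeled by letters of $A$, and a fixed-point-free involution $e\mapsto e^{-1}$ on edges which exchanges initial and terminal vertices and inverts labels, and which is deterministic: for each vertex $v$ and each $a\in A$ there is at most one edge labeled $a$ starting at $v$. It is complete if for each $v$ and $a$ there is at least one such edge. A circuit is a walk whose initial and terminal vertices coincide (the empty walk is allowed). For $x\in V(\Gamma)$, $L(\Gamma,x)\subseteq A^*$ is the set of labels of circuits at $x$. $\Gamma$ is context-free if $L(\Gamma,x_0)$ is a context-free language for some (equivalently, every) vertex $x_0$. For a complete $A$-graph $\Gamma$ put $\mathcal{L}(\Gamma)=\bigcap_{p\in V(\Gamma)}L(\Gamma,p)$. For complete $A$-graphs $\Gamma^{(1)},\ldots,\Gamma^{(k)}$ the transition group $\mathcal{G}(\Gamma^{(1)}\sqcup\cdots\sqcup\Gamma^{(k)})$ is the quotient of $F_A$ by the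 normal subgroup defined by $\bigcap_{i=1}^k\mathcal{L}(\Gamma^{(i)})$; equivalently, it is the group of permutations of the disjoint union of the sets $V(\Gamma^{(i)})$ generated by the permutations induced by the letters of $A$ (each letter $a$ sends $v$ to the endpoint of the $a$-edge starting at $v$). The word problem of a group $G$ generated by (the image of) $A$ is the set of words in $A^*$ representing the identity of $G$. *)

theory Defs
  imports
    "Graph_Theory.Bidirected_Digraph"
    "Graph_Theory.Arc_Walk"
    "Graph_Theory.Digraph_Component"
    "HOL-Algebra.Coset"
begin

section \<open>Context-free languages\<close>

datatype ('n, 't) sym = Nt 'n | Tm 't

type_synonym ('n, 't) prods = "('n \<times> ('n, 't) sym list) set"

inductive derive_step :: "('n, 't) prods \<Rightarrow> ('n, 't) sym list \<Rightarrow> ('n, 't) sym list \<Rightarrow> bool"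
  for P :: "('n, 't) prods" where
  "(X, \<alpha>) \<in> P \<Longrightarrow> derive_step P (u @ [Nt X] @ v) (u @ \<alpha> @ v)"

definition cfg_lang :: "('n, 't) prods \<Rightarrow> 'n \<Rightarrow> 't list set" where
  "cfg_lang P S = {w. (derive_step P)\<^sup>*\<^sup>* [Nt S] (map Tm w)}"

text \<open>
  HOL cannot quantify existentially over the type of nonterminals. A grammar has only finitely
  many of them, so natural numbers suffice; see \<open>context_free_cfg_lang\<close> below.
\<close>

definition context_free :: "'t list set \<Rightarrow> bool" where
  "context_free L \<longleftrightarrow> (\<exists>(P :: (nat, 't) prods) S. finite P \<and> L = cfg_lang P S)"

definition nts :: "('n, 't) sym list \<Rightarrow> 'n set" where
  "nts xs = {X. Nt X \<in> set xs}"

definition rename_prods :: "('n \<Rightarrow> 'm) \<Rightarrow> ('n, 't) prods \<Rightarrow> ('m, 't) prods" where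
  "rename_prods f P = (\<lambda>(X, \<alpha>). (f X, map (map_sym f id) \<alpha>)) ` P"

lemma finite_nts: "finite (nts xs)"
proof -
  have "nts xs \<subseteq> (\<lambda>s. case s of Nt X \<Rightarrow> X) ` set xs"
    by (force simp: nts_def)
  then show ?thesis by (rule finite_subset) simp
qed

lemma nts_append [simp]: "nts (u @ v) = nts u \<union> nts v"
  by (auto simp: nts_def)

lemma derive_step_rename:
  assumes "derive_step P x y"
  shows "derive_step (rename_prods f P) (map (map_sym f id) x) (map (map_sym f id) y)"
  using assms
proof cases
  case (1 X \<alpha> u v)
  then have "(f X, map (map_sym f id) \<alpha>) \<in> rename_prods f P"
    by (force simp: rename_prods_def)
  from derive_step.intros[OF this, of "map (map_sym f id) u" "map (map_sym f id) v"]
  show ?thesis using 1 by simp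
qed

lemma cfg_lang_rename_subset: "cfg_lang P S \<subseteq> cfg_lang (rename_prods f P) (f S)"
proof
  fix w assume "w \<in> cfg_lang P S"
  then have d: "(derive_step P)\<^sup>*\<^sup>* [Nt S] (map Tm w)" by (simp add: cfg_lang_def)
  have "(derive_step (rename_prods f P))\<^sup>*\<^sup>* (map (map_sym f id) x) (map (map_sym f id) y)"
    if "(derive_step P)\<^sup>*\<^sup>* x y" for x y
    using that
    by (induction rule: rtranclp_induct)
      (simp, blast intro: rtranclp.rtrancl_into_rtrancl derive_step_rename)
  from this[OF d] show "w \<in> cfg_lang (rename_prods f P) (f S)"
    by (simp add: cfg_lang_def o_def)
qed

lemma context_free_cfg_lang:
  fixes P :: "('n, 't) prods"
  assumes "finite P"
  shows "context_free (cfg_lang P S)"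
proof -
  define N where "N = insert S (fst ` P \<union> (\<Union>p\<in>P. nts (snd p)))"
  have "finite N"
    unfolding N_def using assms by (simp add: finite_nts)
  then obtain f :: "'n \<Rightarrow> nat" where f: "inj_on f N"
    by (metis finite_imp_inj_to_nat_seg)
  define g where "g = inv_into N f"
  have g: "g (f X) = X" if "X \<in> N" for X
    using f that by (simp add: g_def)
  have inv: "map (map_sym g id) (map (map_sym f id) \<alpha>) = \<alpha>" if "nts \<alpha> \<subseteq> N"
    for \<alpha> :: "('n, 't) sym list"
    using that
  proof (induction \<alpha>)
    case (Cons s \<alpha>)
    then show ?case by (cases s) (auto simp: nts_def g)
  qed simp
  have P: "X \<in> N" "nts \<alpha> \<subseteq> N" if "(X, \<alpha>) \<in> P" for X \<alpha>
    unfolding N_def using that by force+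
  have "rename_prods g (rename_prods f P) = (\<lambda>p. p) ` P"
    unfolding rename_prods_def image_image
  proof (rule image_cong[OF refl])
    fix p assume "p \<in> P"
    moreover obtain X \<alpha> where "p = (X, \<alpha>)" by force
    ultimately show "(case case p of (X, \<alpha>) \<Rightarrow> (f X, map (map_sym f id) \<alpha>) of
        (X, \<alpha>) \<Rightarrow> (g X, map (map_sym g id) \<alpha>)) = p"
      using P[of X \<alpha>] g[of X] inv[of \<alpha>] by simp
  qed
  then have "rename_prods g (rename_prods f P) = P" by simp
  then have "cfg_lang (rename_prods f P) (f S) \<subseteq> cfg_lang P S"
    using cfg_lang_rename_subset[of "rename_prods f P" "f S" g] g[of S] by (simp add: N_def)
  then have "cfg_lang P S = cfg_lang (rename_prods f P) (f S)"
    by (intro equalityI cfg_lang_rename_subset)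
  moreover have "finite (rename_prods f P)"
    using assms by (simp add: rename_prods_def)
  ultimately show ?thesis
    unfolding context_free_def by (intro exI conjI)
qed


section \<open>The free group on an involutive alphabet\<close>

locale involutive_alphabet =
  fixes A :: "'a set" and ainv :: "'a \<Rightarrow> 'a"
  assumes finite_alphabet: "finite A"
    and ainv_closed: "a \<in> A \<Longrightarrow> ainv a \<in> A"
    and ainv_neq: "a \<in> A \<Longrightarrow> ainv a \<noteq> a"
    and ainv_ainv: "a \<in> A \<Longrightarrow> ainv (ainv a) = a"

definition reduced :: "('a \<Rightarrow> 'a) \<Rightarrow> 'a list \<Rightarrow> bool" where
  "reduced ainv w \<longleftrightarrow> (\<nexists>u a v. w = u @ [a, ainv a] @ v)"

definition reduce_Cons :: "('a \<Rightarrow> 'a) \<Rightarrow> 'a \<Rightarrow> 'a list \<Rightarrow> 'a list" where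
  "reduce_Cons ainv a w = (case w of [] \<Rightarrow> [a] | b # w' \<Rightarrow> if b = ainv a then w' else a # w)"

definition reduce :: "('a \<Rightarrow> 'a) \<Rightarrow> 'a list \<Rightarrow> 'a list" where
  "reduce ainv w = foldr (reduce_Cons ainv) w []"

definition free_group :: "'a set \<Rightarrow> ('a \<Rightarrow> 'a) \<Rightarrow> 'a list monoid" where
  "free_group A ainv =
    \<lparr>carrier = {w \<in> lists A. reduced ainv w},
     monoid.mult = (\<lambda>u v. reduce ainv (u @ v)),
     one = []\<rparr>"

lemma reduced_Nil [simp]: "reduced ainv []"
  by (simp add: reduced_def)

lemma reduced_Cons:
  "reduced ainv (a # w) \<longleftrightarrow> reduced ainv w \<and> (w = [] \<or> hd w \<noteq> ainv a)"
proof -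
  have "(\<exists>u c v. a # w = u @ [c, ainv c] @ v) \<longleftrightarrow>
    (\<exists>u c v. w = u @ [c, ainv c] @ v) \<or> (w \<noteq> [] \<and> hd w = ainv a)"
    (is "?l \<longleftrightarrow> ?r")
  proof
    assume ?l
    then obtain u c v where "a # w = u @ [c, ainv c] @ v" by blast
    then show ?r by (cases u) auto
  next
    assume ?r
    then show ?l
    proof
      assume "\<exists>u c v. w = u @ [c, ainv c] @ v"
      then obtain u c v where "a # w = (a # u) @ [c, ainv c] @ v" by auto
      then show ?l by blast
    next
      assume "w \<noteq> [] \<and> hd w = ainv a"
      then have "a # w = [] @ [a, ainv a] @ tl w" by (cases w) auto
      then show ?l by blast
    qed
  qed
  then show ?thesis unfolding reduced_def by blast
qed

lemma reduce_simps [simp]: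
  "reduce ainv [] = []" "reduce ainv (a # w) = reduce_Cons ainv a (reduce ainv w)"
  by (simp_all add: reduce_def)

lemma reduced_reduce_Cons: "reduced ainv w \<Longrightarrow> reduced ainv (reduce_Cons ainv a w)"
  by (auto simp: reduce_Cons_def reduced_Cons split: list.splits)

lemma reduced_reduce: "reduced ainv (reduce ainv w)"
  by (induction w) (auto intro: reduced_reduce_Cons)

lemma reduce_id: "reduced ainv w \<Longrightarrow> reduce ainv w = w"
  by (induction w) (auto simp: reduced_Cons reduce_Cons_def split: list.splits)

lemma reduce_append: "reduce ainv (u @ v) = foldr (reduce_Cons ainv) u (reduce ainv v)"
  by (simp add: reduce_def)

lemma reduce_lists: "w \<in> lists A \<Longrightarrow> reduce ainv w \<in> lists A"
  by (induction w rule: list.induct) (auto simp: reduce_Cons_def split: list.splits)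

context involutive_alphabet
begin

lemma reduce_Cons_cancel:
  assumes "a \<in> A" "reduced ainv w"
  shows "reduce_Cons ainv a (reduce_Cons ainv (ainv a) w) = w"
  using assms ainv_ainv[of a] ainv_neq[of a]
  by (auto simp: reduce_Cons_def reduced_Cons split: list.splits)

lemma reduced_foldr: "reduced ainv v \<Longrightarrow> reduced ainv (foldr (reduce_Cons ainv) u v)"
  by (induction u) (auto intro: reduced_reduce_Cons)

lemma foldr_reduce_Cons:
  assumes "a \<in> A" "reduced ainv v"
  shows "foldr (reduce_Cons ainv) (reduce_Cons ainv a w) v
    = reduce_Cons ainv a (foldr (reduce_Cons ainv) w v)"
  using assms reduce_Cons_cancel[OF assms(1) reduced_foldr[OF assms(2)]]
  by (auto simp: reduce_Cons_def[of ainv a w] split: list.splits)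

lemma foldr_reduce:
  assumes "u \<in> lists A" "reduced ainv v"
  shows "foldr (reduce_Cons ainv) (reduce ainv u) v = foldr (reduce_Cons ainv) u v"
  using assms by (induction u) (auto simp: foldr_reduce_Cons)

lemma reduce_append_left: "u \<in> lists A \<Longrightarrow> reduce ainv (reduce ainv u @ v) = reduce ainv (u @ v)"
  by (simp add: reduce_append foldr_reduce reduced_reduce)

lemma reduce_append_right: "reduce ainv (u @ reduce ainv v) = reduce ainv (u @ v)"
  by (simp add: reduce_append reduce_id reduced_reduce)

lemma reduce_inverse_word:
  "w \<in> lists A \<Longrightarrow> reduce ainv (w @ rev (map ainv w)) = []"
  "w \<in> lists A \<Longrightarrow> reduce ainv (rev (map ainv w) @ w) = []"
proof -
  have *: "reduce ainv (w @ rev (map ainv w) @ v) = reduce ainv v" if "w \<in> lists A" for w v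
    using that
  proof (induction w arbitrary: v)
    case (Cons a w)
    then have "reduce ainv (w @ rev (map ainv w) @ [ainv a] @ v) = reduce ainv ([ainv a] @ v)"
      by blast
    then show ?case using Cons.hyps reduce_Cons_cancel[OF _ reduced_reduce] by simp
  qed simp
  then show "reduce ainv (w @ rev (map ainv w)) = []" if "w \<in> lists A"
    using that *[of w "[]"] by simp
  show "reduce ainv (rev (map ainv w) @ w) = []" if w: "w \<in> lists A"
  proof -
    have "map (ainv \<circ> ainv) w = w"
      using w ainv_ainv by (induction w) auto
    moreover have "rev (map ainv w) \<in> lists A"
      using w ainv_closed by (auto simp: in_lists_conv_set)
    ultimately show ?thesis
      using *[of "rev (map ainv w)" "[]"] by (simp add: rev_map)
  qed
qed

lemma group_free_group: "group (free_group A ainv)"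
proof (rule groupI)
  fix x y z
  assume x: "x \<in> carrier (free_group A ainv)" and y: "y \<in> carrier (free_group A ainv)"
    and z: "z \<in> carrier (free_group A ainv)"
  show "x \<otimes>\<^bsub>free_group A ainv\<^esub> y \<otimes>\<^bsub>free_group A ainv\<^esub> z
      = x \<otimes>\<^bsub>free_group A ainv\<^esub> (y \<otimes>\<^bsub>free_group A ainv\<^esub> z)"
    using x y z reduce_append_left[of "x @ y" z] reduce_append_right[of x "y @ z"]
    by (simp add: free_group_def)
next
  fix x assume x: "x \<in> carrier (free_group A ainv)"
  then have x': "x \<in> lists A" by (simp add: free_group_def)
  then have inv: "rev (map ainv x) \<in> lists A"
    using ainv_closed by (auto simp: in_lists_conv_set)
  have "reduce ainv (reduce ainv (rev (map ainv x)) @ x) = []"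
    using reduce_append_left[OF inv] reduce_inverse_word(2)[OF x'] by simp
  then show "\<exists>y\<in>carrier (free_group A ainv). y \<otimes>\<^bsub>free_group A ainv\<^esub> x = \<one>\<^bsub>free_group A ainv\<^esub>"
    using reduce_lists[OF inv] reduced_reduce
    by (intro bexI[of _ "reduce ainv (rev (map ainv x))"])
      (simp_all add: free_group_def del: in_lists_conv_set)
qed (simp_all add: free_group_def reduce_id reduced_reduce reduce_lists del: in_lists_conv_set)

end


section \<open>Inverse digraphs over an involutive alphabet\<close>

record ('v, 'e, 'a) labeled_digraph =
  dgraph :: "('v, 'e) pre_digraph"
  einv :: "'e \<Rightarrow> 'e"
  label :: "'e \<Rightarrow> 'a"

text \<open>
  In \<^locale>\<open>bidirected_digraph\<close> the reversal map is total and is the identity exactly off the arc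
  set; restricted to the arcs it is a fixed-point-free involution exchanging tail and head.
  The predicate \<^const>\<open>connected\<close> includes that there is at least one vertex.
\<close>

locale A_graph =
  involutive_alphabet A ainv + bidirected_digraph "dgraph \<Gamma>" "einv \<Gamma>"
  for A :: "'a set" and ainv :: "'a \<Rightarrow> 'a" and \<Gamma> :: "('v, 'e, 'a) labeled_digraph" +
  assumes connected_graph: "connected (dgraph \<Gamma>)"
    and label_closed: "e \<in> arcs (dgraph \<Gamma>) \<Longrightarrow> label \<Gamma> e \<in> A"
    and label_einv: "e \<in> arcs (dgraph \<Gamma>) \<Longrightarrow> label \<Gamma> (einv \<Gamma> e) = ainv (label \<Gamma> e)"
    and deterministic:
      "\<lbrakk>e \<in> arcs (dgraph \<Gamma>); f \<in> arcs (dgraph \<Gamma>);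
        tail (dgraph \<Gamma>) e = tail (dgraph \<Gamma>) f; label \<Gamma> e = label \<Gamma> f\<rbrakk> \<Longrightarrow> e = f"

definition complete_graph :: "'a set \<Rightarrow> ('v, 'e, 'a) labeled_digraph \<Rightarrow> bool" where
  "complete_graph A \<Gamma> \<longleftrightarrow>
    (\<forall>v\<in>verts (dgraph \<Gamma>). \<forall>a\<in>A. \<exists>e\<in>arcs (dgraph \<Gamma>). tail (dgraph \<Gamma>) e = v \<and> label \<Gamma> e = a)"

definition circuit_lang :: "('v, 'e, 'a) labeled_digraph \<Rightarrow> 'v \<Rightarrow> 'a list set" where
  "circuit_lang \<Gamma> x = {map (label \<Gamma>) es | es. pre_digraph.awalk (dgraph \<Gamma>) x es x}"

definition context_free_graph :: "('v, 'e, 'a) labeled_digraph \<Rightarrow> bool" where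
  "context_free_graph \<Gamma> \<longleftrightarrow> (\<exists>x\<in>verts (dgraph \<Gamma>). context_free (circuit_lang \<Gamma> x))"

definition common_circuit_lang :: "('v, 'e, 'a) labeled_digraph \<Rightarrow> 'a list set" where
  "common_circuit_lang \<Gamma> = (\<Inter>p\<in>verts (dgraph \<Gamma>). circuit_lang \<Gamma> p)"


section \<open>The transition group\<close>

text \<open>
  The family is indexed by an arbitrary set \<open>I\<close>; intersecting with \<^term>\<open>lists A\<close> only matters
  for empty \<open>I\<close>. The kernel is the image of the intersected languages in the free group.
\<close>

definition transition_kernel ::
  "'a set \<Rightarrow> ('a \<Rightarrow> 'a) \<Rightarrow> 'i set \<Rightarrow> ('i \<Rightarrow> ('v, 'e, 'a) labeled_digraph) \<Rightarrow> 'a list set" where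
  "transition_kernel A ainv I \<Gamma> = reduce ainv ` (lists A \<inter> (\<Inter>i\<in>I. common_circuit_lang (\<Gamma> i)))"

lemma inverse_word_lists:
  "involutive_alphabet A ainv \<Longrightarrow> w \<in> lists A \<Longrightarrow> rev (map ainv w) \<in> lists A"
  using involutive_alphabet.ainv_closed by (fastforce simp: in_lists_conv_set)

context A_graph
begin

lemma awalk_rev:
  "awalk u es v \<Longrightarrow> awalk v (rev (map (einv \<Gamma>) es)) u"
proof (induction es arbitrary: u)
  case (Cons e es)
  then have e: "e \<in> arcs (dgraph \<Gamma>)" "tail (dgraph \<Gamma>) e = u"
    and "awalk v (rev (map (einv \<Gamma>) es)) (head (dgraph \<Gamma>) e)"
    by (auto simp: awalk_Cons_iff)
  moreover from e have "awalk (head (dgraph \<Gamma>) e) [einv \<Gamma> e] u"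
    by (auto simp: awalk_Cons_iff awalk_Nil_iff)
  ultimately show ?case using awalk_appendI by force
qed (simp add: awalk_Nil_iff)

lemma label_awalk_rev:
  assumes "awalk u es v"
  shows "map (label \<Gamma>) (rev (map (einv \<Gamma>) es)) = rev (map ainv (map (label \<Gamma>) es))"
proof -
  have "set es \<subseteq> arcs (dgraph \<Gamma>)" using assms by (simp add: awalk_def)
  then show ?thesis by (induction es) (auto simp: label_einv)
qed

lemma circuit_lang_append:
  "\<lbrakk>v \<in> circuit_lang \<Gamma> p; w \<in> circuit_lang \<Gamma> p\<rbrakk> \<Longrightarrow> v @ w \<in> circuit_lang \<Gamma> p"
  unfolding circuit_lang_def by clarsimp (metis awalk_appendI map_append)

lemma circuit_lang_inverse:
  "w \<in> circuit_lang \<Gamma> p \<Longrightarrow> rev (map ainv w) \<in> circuit_lang \<Gamma> p"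
  unfolding circuit_lang_def using awalk_rev label_awalk_rev by (smt (verit) mem_Collect_eq)

lemma complete_walk:
  assumes "complete_graph A \<Gamma>" "w \<in> lists A" "p \<in> verts (dgraph \<Gamma>)"
  shows "\<exists>es q. awalk p es q \<and> map (label \<Gamma>) es = w"
  using assms(2,3)
proof (induction w arbitrary: p)
  case Nil
  then have "awalk p [] p \<and> map (label \<Gamma>) [] = []" by (simp add: awalk_Nil_iff)
  then show ?case by blast
next
  case (Cons a w)
  then obtain e where e: "e \<in> arcs (dgraph \<Gamma>)" "tail (dgraph \<Gamma>) e = p" "label \<Gamma> e = a"
    using assms(1) unfolding complete_graph_def by (metis listsE)
  moreover from Cons.IH[OF head_in_verts[OF e(1)]]
  obtain es q where "awalk (head (dgraph \<Gamma>) e) es q" "map (label \<Gamma>) es = w"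
    by blast
  ultimately have "awalk p (e # es) q \<and> map (label \<Gamma>) (e # es) = a # w"
    using e by (simp add: awalk_Cons_iff)
  then show ?case by (intro exI)
qed

lemma common_circuit_lang_conj:
  assumes "complete_graph A \<Gamma>" "u \<in> lists A" "w \<in> common_circuit_lang \<Gamma>"
  shows "u @ w @ rev (map ainv u) \<in> common_circuit_lang \<Gamma>"
  unfolding common_circuit_lang_def
proof
  fix p assume "p \<in> verts (dgraph \<Gamma>)"
  then obtain es q where es: "awalk p es q" "map (label \<Gamma>) es = u"
    using complete_walk assms by blast
  then have "w \<in> circuit_lang \<Gamma> q"
    using assms(3) awalk_last_in_verts unfolding common_circuit_lang_def by blast
  then obtain fs where fs: "awalk q fs q" "map (label \<Gamma>) fs = w"
    unfolding circuit_lang_def by blast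
  have "awalk p (es @ fs @ rev (map (einv \<Gamma>) es)) p"
    using es fs awalk_rev awalk_appendI by meson
  moreover have "map (label \<Gamma>) (es @ fs @ rev (map (einv \<Gamma>) es)) = u @ w @ rev (map ainv u)"
    using es fs label_awalk_rev[OF es(1)] by simp
  ultimately show "u @ w @ rev (map ainv u) \<in> circuit_lang \<Gamma> p"
    unfolding circuit_lang_def by (metis (mono_tags, lifting) mem_Collect_eq)
qed

end

lemma normal_transition_kernel:
  assumes alph: "involutive_alphabet A ainv"
    and graphs: "\<And>i. i \<in> I \<Longrightarrow> A_graph A ainv (\<Gamma> i)"
    and complete: "\<And>i. i \<in> I \<Longrightarrow> complete_graph A (\<Gamma> i)"
  shows "transition_kernel A ainv I \<Gamma> \<lhd> free_group A ainv"
proof -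
  interpret involutive_alphabet A ainv by (fact alph)
  interpret F: group "free_group A ainv" by (rule group_free_group)
  define K where "K = lists A \<inter> (\<Inter>i\<in>I. common_circuit_lang (\<Gamma> i))"
  have kernel: "transition_kernel A ainv I \<Gamma> = reduce ainv ` K"
    by (simp add: transition_kernel_def K_def)
  have lists: "w \<in> lists A" if "w \<in> K" for w using that by (simp add: K_def)
  have Nil: "[] \<in> K"
  proof -
    have "[] \<in> circuit_lang (\<Gamma> i) p" if "i \<in> I" "p \<in> verts (dgraph (\<Gamma> i))" for i p
      using that by (simp add: circuit_lang_def pre_digraph.awalk_def pre_digraph.cas.simps)
    then show ?thesis by (simp add: K_def common_circuit_lang_def)
  qed
  have append: "v @ w \<in> K" if "v \<in> K" "w \<in> K" for v w
    using that A_graph.circuit_lang_append[OF graphs] unfolding K_def common_circuit_lang_def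
    by simp
  have inverse: "rev (map ainv w) \<in> K" if "w \<in> K" for w
    using that A_graph.circuit_lang_inverse[OF graphs] inverse_word_lists[OF alph, of w]
    unfolding K_def common_circuit_lang_def by blast
  have conj: "u @ w @ rev (map ainv u) \<in> K" if "u \<in> lists A" "w \<in> K" for u w
    using that A_graph.common_circuit_lang_conj[OF graphs complete, of _ u w]
      inverse_word_lists[OF alph, of u]
    unfolding K_def by (auto simp del: in_lists_conv_set)
  have carrier: "reduce ainv w \<in> carrier (free_group A ainv)" if "w \<in> lists A" for w
    using reduce_lists[OF that] reduced_reduce
    by (simp add: free_group_def del: in_lists_conv_set)
  have mult: "reduce ainv v \<otimes>\<^bsub>free_group A ainv\<^esub> reduce ainv w = reduce ainv (v @ w)"
    if "v \<in> lists A" for v w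
    using that reduce_append_left reduce_append_right by (simp add: free_group_def)
  have minv: "inv\<^bsub>free_group A ainv\<^esub> reduce ainv w = reduce ainv (rev (map ainv w))"
    if "w \<in> lists A" for w
  proof (rule F.inv_equality)
    show "reduce ainv (rev (map ainv w)) \<otimes>\<^bsub>free_group A ainv\<^esub> reduce ainv w
        = \<one>\<^bsub>free_group A ainv\<^esub>"
      using mult[OF inverse_word_lists[OF alph that], of w] reduce_inverse_word(2)[OF that]
      by (simp add: free_group_def)
  qed (rule carrier[OF that], rule carrier[OF inverse_word_lists[OF alph that]])
  have "subgroup (reduce ainv ` K) (free_group A ainv)"
  proof (rule F.subgroupI)
    show "reduce ainv ` K \<subseteq> carrier (free_group A ainv)" using carrier lists by blast
    show "reduce ainv ` K \<noteq> {}" using Nil by blast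
  next
    fix x assume "x \<in> reduce ainv ` K"
    then show "inv\<^bsub>free_group A ainv\<^esub> x \<in> reduce ainv ` K"
      using minv inverse lists by auto
  next
    fix x y assume "x \<in> reduce ainv ` K" "y \<in> reduce ainv ` K"
    then show "x \<otimes>\<^bsub>free_group A ainv\<^esub> y \<in> reduce ainv ` K"
      using mult append lists by auto
  qed
  moreover have "x \<otimes>\<^bsub>free_group A ainv\<^esub> h \<otimes>\<^bsub>free_group A ainv\<^esub> inv\<^bsub>free_group A ainv\<^esub> x
      \<in> reduce ainv ` K"
    if x: "x \<in> carrier (free_group A ainv)" and h: "h \<in> reduce ainv ` K" for x h
  proof -
    obtain w where w: "w \<in> K" "h = reduce ainv w" using h by blast
    have x': "x \<in> lists A" "reduce ainv x = x"
      using x reduce_id[of ainv x] by (simp_all add: free_group_def)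
    have "x @ w \<in> lists A" using x' lists[OF w(1)] by simp
    then have "x \<otimes>\<^bsub>free_group A ainv\<^esub> h \<otimes>\<^bsub>free_group A ainv\<^esub> inv\<^bsub>free_group A ainv\<^esub> x
        = reduce ainv ((x @ w) @ rev (map ainv x))"
      using mult[OF x'(1), of w] mult[of "x @ w" "rev (map ainv x)"] minv[OF x'(1)] x' w by metis
    then show ?thesis using conj[OF x'(1) w(1)] by simp
  qed
  ultimately show ?thesis
    unfolding kernel by (intro F.normal_invI)
qed

definition transition_group ::
  "'a set \<Rightarrow> ('a \<Rightarrow> 'a) \<Rightarrow> 'i set \<Rightarrow> ('i \<Rightarrow> ('v, 'e, 'a) labeled_digraph) \<Rightarrow> 'a list set monoid" where
  "transition_group A ainv I \<Gamma> = free_group A ainv Mod transition_kernel A ainv I \<Gamma>"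

definition transition_letter ::
  "'a set \<Rightarrow> ('a \<Rightarrow> 'a) \<Rightarrow> 'i set \<Rightarrow> ('i \<Rightarrow> ('v, 'e, 'a) labeled_digraph) \<Rightarrow> 'a \<Rightarrow> 'a list set" where
  "transition_letter A ainv I \<Gamma> a =
    transition_kernel A ainv I \<Gamma> #>\<^bsub>free_group A ainv\<^esub> [a]"


section \<open>Word problems\<close>

definition word_value :: "('g, 'r) monoid_scheme \<Rightarrow> ('a \<Rightarrow> 'g) \<Rightarrow> 'a list \<Rightarrow> 'g" where
  "word_value G \<phi> w = foldr (\<lambda>a g. \<phi> a \<otimes>\<^bsub>G\<^esub> g) w \<one>\<^bsub>G\<^esub>"

definition word_problem :: "'a set \<Rightarrow> ('g, 'r) monoid_scheme \<Rightarrow> ('a \<Rightarrow> 'g) \<Rightarrow> 'a list set" where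
  "word_problem A G \<phi> = {w \<in> lists A. word_value G \<phi> w = \<one>\<^bsub>G\<^esub>}"

definition co_context_free :: "'a set \<Rightarrow> ('g, 'r) monoid_scheme \<Rightarrow> ('a \<Rightarrow> 'g) \<Rightarrow> bool" where
  "co_context_free A G \<phi> \<longleftrightarrow> context_free (lists A - word_problem A G \<phi>)"

end

theory Submission
  imports Defs
begin

text \<open>
  A word represents a nontrivial element of the transition group if and only if it moves some
  vertex of one of the graphs. So the words that move some vertex of a complete context-free
  graph have to be generated by a grammar, although it is not the circuits but their complement that
  is wanted.

  Fix a root \<open>x0\<close> for which the language of circuits is context-free, and let the level of a
  vertex be its distance from \<open>x0\<close>. If \<open>w\<close> moves \<open>r\<close> to \<open>s\<close>, its walk passes through a vertex
  \<open>p\<close> of least level, so \<open>w = v @ u\<close> where \<open>v\<close> leads from \<open>r\<close> to \<open>p\<close> and \<open>u\<close> leads from \<open>p\<close>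
  to \<open>s\<close>, both without going below \<open>p\<close>. Read instead \<open>u\<close>, a marker, and then \<open>v\<close>: from \<open>p\<close> up to
  \<open>s\<close>, a jump to the different vertex \<open>r\<close>, and back to \<open>p\<close>. Such a marked word is nested by levels.
  Splitting off excursions between vertices of equal level, and then the two outer letters that
  lead one level up, ends with two vertices that are visibly different or lie on different
  levels (\<open>factors_separations\<close>). Turning the grammar of the marked words inside out
  (\<open>context_free_inside_out\<close>) brings \<open>v\<close> back in front of \<open>u\<close>.

  All this yields a finite grammar because only finitely many different languages occur
  as the sets of words whose walks from \<open>p\<close> to \<open>q\<close> stay above the common level of \<open>p\<close> and \<open>q\<close>.
  Here the context-free grammar for the circuits at \<open>x0\<close> is used. If \<open>w\<close> is such a word, put
  geodesics between \<open>x0\<close> and \<open>p\<close>, \<open>q\<close> around it. In a derivation tree of the resulting circuit, the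
  node where \<open>w\<close> is first cut covers only boundedly many letters outside \<open>w\<close>, because the cut lies
  on a high level and a subtree spans a bounded distance (\<open>bounded_factor\<close>). So \<open>w\<close> belongs to one
  of finitely many languages, each of them read off a node and two short words, and all words of
  that language lead from \<open>p\<close> to \<open>q\<close> as well. These languages may contain words that
  go below the level, but they determine where a walk leaves the upper part of the graph, and
  hence they determine the wanted languages (\<open>finite_langs\<close>). Once a family of languages is known to
  be finite, its members serve as nonterminals, and being context-free amounts to being able to
  factor words within the family (\<open>context_free_if_factors_in\<close>).
\<close>

section \<open>Derivation trees\<close>

text \<open>
  Derivability of a terminal word, arranged as an induction over the derivation tree of a
  sentential form. Arguments about the subword a subtree covers are then plain structural inductions.
\<close>

inductive yields :: "('n, 't) prods \<Rightarrow> ('n, 't) sym list \<Rightarrow> 't list \<Rightarrow> bool"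
  for P :: "('n, 't) prods" where
  yields_Nil: "yields P [] []"
| yields_Tm: "yields P \<gamma> w \<Longrightarrow> yields P (Tm a # \<gamma>) (a # w)"
| yields_Nt: "\<lbrakk>(X, \<delta>) \<in> P; yields P \<delta> u; yields P \<gamma> v\<rbrakk> \<Longrightarrow> yields P (Nt X # \<gamma>) (u @ v)"

inductive_cases yields_NilE: "yields P [] w"
inductive_cases yields_TmE: "yields P (Tm a # \<gamma>) w"
inductive_cases yields_NtE: "yields P (Nt X # \<gamma>) w"

lemma yields_append:
  "\<lbrakk>yields P \<alpha> u; yields P \<beta> v\<rbrakk> \<Longrightarrow> yields P (\<alpha> @ \<beta>) (u @ v)"
  by (induction rule: yields.induct) (auto intro: yields.intros)

lemma yields_appendE:
  assumes "yields P (\<alpha> @ \<beta>) w"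
  obtains u v where "w = u @ v" "yields P \<alpha> u" "yields P \<beta> v"
proof -
  have "\<exists>u v. w = u @ v \<and> yields P \<alpha> u \<and> yields P \<beta> v"
    using assms
  proof (induction \<alpha> arbitrary: w)
    case Nil
    then show ?case using yields_Nil by fastforce
  next
    case (Cons s \<alpha>)
    show ?case
    proof (cases s)
      case (Nt X)
      with Cons.prems obtain \<delta> x y
        where x: "(X, \<delta>) \<in> P" "yields P \<delta> x" "yields P (\<alpha> @ \<beta>) y" "w = x @ y"
        by (auto elim: yields_NtE)
      from Cons.IH[OF x(3)] obtain u v where "y = u @ v" "yields P \<alpha> u" "yields P \<beta> v"
        by blast
      moreover from this x have "yields P (s # \<alpha>) (x @ u)"
        unfolding Nt by (blast intro: yields_Nt)
      ultimately show ?thesis using x(4) by (metis append.assoc)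
    next
      case (Tm a)
      with Cons.prems obtain y where y: "yields P (\<alpha> @ \<beta>) y" "w = a # y"
        by (auto elim: yields_TmE)
      from Cons.IH[OF y(1)] obtain u v where "y = u @ v" "yields P \<alpha> u" "yields P \<beta> v"
        by blast
      then show ?thesis using y(2) Tm by (metis append_Cons yields_Tm)
    qed
  qed
  then show ?thesis using that by blast
qed

lemma yields_single_Nt: "yields P [Nt X] w \<longleftrightarrow> (\<exists>\<delta>. (X, \<delta>) \<in> P \<and> yields P \<delta> w)"
proof
  assume "yields P [Nt X] w"
  then show "\<exists>\<delta>. (X, \<delta>) \<in> P \<and> yields P \<delta> w" by (force elim: yields_NtE yields_NilE)
next
  assume "\<exists>\<delta>. (X, \<delta>) \<in> P \<and> yields P \<delta> w"
  then show "yields P [Nt X] w" using yields_Nt[OF _ _ yields_Nil] by fastforce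
qed

lemma yields_map_Tm: "yields P (map Tm w) w"
  by (induction w) (auto intro: yields.intros)

lemma derive_step_context:
  "derive_step P x y \<Longrightarrow> derive_step P (p @ x @ q) (p @ y @ q)"
proof (induction rule: derive_step.induct)
  case (1 X \<alpha> u v)
  from derive_step.intros[OF this, of "p @ u" "v @ q"] show ?case by simp
qed

lemma derives_context:
  "(derive_step P)\<^sup>*\<^sup>* x y \<Longrightarrow> (derive_step P)\<^sup>*\<^sup>* (p @ x @ q) (p @ y @ q)"
  by (induction rule: rtranclp_induct)
    (auto intro: rtranclp.rtrancl_into_rtrancl derive_step_context)

lemma yields_imp_derives:
  "yields P \<gamma> w \<Longrightarrow> (derive_step P)\<^sup>*\<^sup>* \<gamma> (map Tm w)"
proof (induction rule: yields.induct)
  case (yields_Tm \<gamma> w a)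
  from derives_context[OF yields_Tm.IH, of "[Tm a]" "[]"] show ?case by simp
next
  case (yields_Nt X \<delta> u \<gamma> v)
  have "derive_step P (Nt X # \<gamma>) (\<delta> @ \<gamma>)"
    using derive_step.intros[OF yields_Nt.hyps(1), of "[]" \<gamma>] by simp
  also have "(derive_step P)\<^sup>*\<^sup>* (\<delta> @ \<gamma>) (map Tm u @ \<gamma>)"
    using derives_context[OF yields_Nt.IH(1), of "[]" \<gamma>] by simp
  also have "(derive_step P)\<^sup>*\<^sup>* (map Tm u @ \<gamma>) (map Tm u @ map Tm v)"
    using derives_context[OF yields_Nt.IH(2), of "map Tm u" "[]"] by simp
  finally show ?case by simp
qed simp

lemma derives_imp_yields:
  "(derive_step P)\<^sup>*\<^sup>* \<gamma> (map Tm w) \<Longrightarrow> yields P \<gamma> w"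
proof (induction rule: converse_rtranclp_induct)
  case base
  show ?case by (rule yields_map_Tm)
next
  case (step x y)
  from step.hyps(1) step.IH show ?case
  proof cases
    case (1 X \<alpha> u v)
    with step.IH obtain wu wa wv
      where "w = wu @ wa @ wv" "yields P u wu" "yields P \<alpha> wa" "yields P v wv"
      by (metis yields_appendE)
    moreover from this 1 have "yields P [Nt X] wa" by (auto simp: yields_single_Nt)
    ultimately show ?thesis using 1 by (simp only: yields_append)
  qed
qed

lemma cfg_lang_yields: "cfg_lang P S = {w. yields P [Nt S] w}"
  by (auto simp: cfg_lang_def intro: yields_imp_derives derives_imp_yields)

section \<open>Languages with finitely many factorisation patterns\<close>

primrec sym_lang :: "('n \<Rightarrow> 't list set) \<Rightarrow> ('n, 't) sym \<Rightarrow> 't list set" where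
  "sym_lang I (Nt X) = I X"
| "sym_lang I (Tm a) = {[a]}"

text \<open>
  The value of a sentential form when the nonterminals are interpreted by languages. A grammar is
  sound for an interpretation that is closed under its productions in this sense.
\<close>

primrec conc :: "('n \<Rightarrow> 't list set) \<Rightarrow> ('n, 't) sym list \<Rightarrow> 't list set" where
  "conc I [] = {[]}"
| "conc I (s # \<gamma>) = {u @ v | u v. u \<in> sym_lang I s \<and> v \<in> conc I \<gamma>}"

lemma conc_append: "conc I (\<alpha> @ \<beta>) = {u @ v | u v. u \<in> conc I \<alpha> \<and> v \<in> conc I \<beta>}"
proof (induction \<alpha>)
  case (Cons s \<alpha>)
  show ?case unfolding append_Cons conc.simps Cons.IH by (auto; metis append.assoc)
qed simp

lemma conc_mono: "(\<And>X. I X \<subseteq> J X) \<Longrightarrow> conc I \<gamma> \<subseteq> conc J \<gamma>"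
proof (induction \<gamma>)
  case (Cons s \<gamma>)
  then have "sym_lang I s \<subseteq> sym_lang J s" by (cases s) auto
  then show ?case using Cons by fastforce
qed simp

lemma yields_subset_conc:
  assumes "\<And>X \<alpha>. (X, \<alpha>) \<in> P \<Longrightarrow> conc I \<alpha> \<subseteq> I X"
  shows "yields P \<gamma> w \<Longrightarrow> w \<in> conc I \<gamma>"
proof (induction rule: yields.induct)
  case (yields_Nt X \<delta> u \<gamma> v)
  then show ?case using assms by fastforce
qed auto

text \<open>
  The words \<open>w\<close> to which a production \<open>L \<rightarrow> \<alpha>\<close> applies, where the members of \<open>\<L>\<close> serve
  as their own nonterminals: the production is sound because all products of its right-hand side lie
  in \<open>L\<close>, and it leads to shorter words, so that repeating it terminates.
\<close>

definition factors_in ::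
  "'t set \<Rightarrow> nat \<Rightarrow> 't list set set \<Rightarrow> 't list \<Rightarrow> 't list set \<Rightarrow> bool" where
  "factors_in T b \<L> w L \<longleftrightarrow> (\<exists>\<alpha>. length \<alpha> \<le> b \<and> set \<alpha> \<subseteq> Nt ` \<L> \<union> Tm ` T \<and>
    w \<in> conc (\<lambda>X. {v \<in> X. length v < length w}) \<alpha> \<and> conc (\<lambda>X. X) \<alpha> \<subseteq> L)"

lemma factors_in_mono:
  "\<lbrakk>factors_in T b \<L> w L; \<L> \<subseteq> \<L>'; L \<subseteq> L'\<rbrakk> \<Longrightarrow> factors_in T b \<L>' w L'"
  unfolding factors_in_def by (meson image_mono order_trans subset_refl Un_mono)

text \<open>
  All productions of length at most \<open>b\<close> that are sound for the languages of \<open>\<L>\<close> form one finite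
  grammar. No derivation leaves these languages, and by induction on its length every word in one of
  them has a derivation. To prove a family of languages context-free it is therefore enough to show
  that the family is finite and to factor words; no grammar need be written down.
\<close>

theorem context_free_if_factors_in:
  assumes fin: "finite T" "finite \<L>"
    and factors: "\<And>L w. \<lbrakk>L \<in> \<L>; w \<in> L\<rbrakk> \<Longrightarrow> factors_in T b \<L> w L"
    and L: "L \<in> \<L>"
  shows "context_free L"
proof -
  define P where "P = {(L, \<alpha>). L \<in> \<L> \<and>
    set \<alpha> \<subseteq> Nt ` \<L> \<union> Tm ` T \<and> length \<alpha> \<le> b \<and> conc (\<lambda>X. X) \<alpha> \<subseteq> L}"
  have "P \<subseteq> \<L> \<times> {\<alpha>. set \<alpha> \<subseteq> Nt ` \<L> \<union> Tm ` T \<and> length \<alpha> \<le> b}"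
    by (auto simp: P_def)
  then have finP: "finite P"
    using fin by (elim finite_subset) (intro finite_cartesian_product finite_lists_length_le; simp)
  have "w \<in> L" if "yields P [Nt L] w" for w L
  proof -
    have "w \<in> conc (\<lambda>X. X) [Nt L]"
      by (rule yields_subset_conc[OF _ that]) (auto simp: P_def)
    then show ?thesis by simp
  qed
  moreover have "yields P [Nt L] w" if "w \<in> L" "L \<in> \<L>" for w L
    using that
  proof (induction "length w" arbitrary: w L rule: less_induct)
    case less
    from factors[OF less.prems(2,1)] obtain \<alpha> where \<alpha>: "length \<alpha> \<le> b"
      "set \<alpha> \<subseteq> Nt ` \<L> \<union> Tm ` T" "conc (\<lambda>X. X) \<alpha> \<subseteq> L"
      and w: "w \<in> conc (\<lambda>X. {v \<in> X. length v < length w}) \<alpha>"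
      unfolding factors_in_def by blast
    have "yields P \<beta> v"
      if "v \<in> conc (\<lambda>X. {v \<in> X. length v < length w}) \<beta>" "set \<beta> \<subseteq> Nt ` \<L> \<union> Tm ` T" for \<beta> v
      using that
    proof (induction \<beta> arbitrary: v)
      case Nil
      then show ?case by (simp add: yields_Nil)
    next
      case (Cons s \<beta>)
      then obtain x y where xy: "v = x @ y" "yields P \<beta> y"
        "x \<in> sym_lang (\<lambda>X. {v \<in> X. length v < length w}) s" by auto
      have "yields P [s] x"
      proof (cases s)
        case (Nt X)
        with Cons.prems xy less.hyps show ?thesis by auto
      next
        case (Tm a)
        with xy show ?thesis using yields_map_Tm[of P "[a]"] by simp
      qed
      from yields_append[OF this xy(2)] show ?case by (simp add: xy)
    qed
    from this[OF w \<alpha>(2)] \<alpha> less.prems show ?case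
      by (auto simp: yields_single_Nt P_def)
  qed
  ultimately have "L = cfg_lang P L" using L by (auto simp: cfg_lang_yields)
  then show ?thesis using context_free_cfg_lang[OF finP] by metis
qed

section \<open>Turning a language inside out\<close>

text \<open>
  The marker \<open>None\<close> records where a word is to be cut.
\<close>

definition mark :: "'t list \<Rightarrow> 't list \<Rightarrow> 't option list" where
  "mark u v = map Some u @ None # map Some v"

lemma mark_Cons: "mark (a # u) v = Some a # mark u v"
  by (simp add: mark_def)

lemma mark_eq_Cons:
  "mark u v = t # z \<longleftrightarrow>
    t = None \<and> u = [] \<and> z = map Some v \<or> (\<exists>a u'. t = Some a \<and> u = a # u' \<and> z = mark u' v)"
  by (cases u) (auto simp: mark_def)

lemma mark_inject: "mark u v = mark u' v' \<longleftrightarrow> u = u' \<and> v = v'"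
proof (induction u arbitrary: u')
  case Nil
  then show ?case by (cases u') (auto simp: mark_def inj_map_eq_map)
next
  case (Cons a u)
  then show ?case by (cases u') (auto simp: mark_def)
qed

lemma mark_eq_append:
  assumes "mark u v = x @ y"
  obtains (left) v' v'' where "v = v' @ v''" "x = mark u v'" "y = map Some v''"
  | (right) u' u'' where "u = u' @ u''" "x = map Some u'" "y = mark u'' v"
proof -
  have "(\<exists>v' v''. v = v' @ v'' \<and> x = mark u v' \<and> y = map Some v'') \<or>
    (\<exists>u' u''. u = u' @ u'' \<and> x = map Some u' \<and> y = mark u'' v)"
    using assms
  proof (induction x arbitrary: u)
    case Nil
    then show ?case by simp
  next
    case (Cons t x)
    from Cons.prems have "mark u v = t # (x @ y)" by simp
    then consider "t = None" "u = []" "map Some v = x @ y"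
      | a u' where "t = Some a" "u = a # u'" "mark u' v = x @ y"
      unfolding mark_eq_Cons by metis
    then show ?case
    proof cases
      case 1
      then obtain v' v'' where "v = v' @ v''" "x = map Some v'" "y = map Some v''"
        by (metis map_eq_append_conv)
      then show ?thesis using 1 by (auto simp: mark_def)
    next
      case 2
      from Cons.IH[OF 2(3)] show ?thesis
      proof (elim disjE exE conjE)
        fix v' v'' assume "v = v' @ v''" "x = mark u' v'" "y = map Some v''"
        then show ?thesis using 2 by (intro disjI1 exI[of _ v'] exI[of _ v'']) (simp add: mark_Cons)
      next
        fix w w' assume "u' = w @ w'" "x = map Some w" "y = mark w' v"
        then show ?thesis using 2 by (intro disjI2 exI[of _ "a # w"] exI[of _ w']) simp
      qed
    qed
  qed
  then show ?thesis using left right by blast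
qed

text \<open>
  \<open>Context X\<close> generates \<open>v @ u\<close> for the contexts \<open>(u, v)\<close> of \<open>X\<close>, i.e. those with
  \<open>S \<Rightarrow>\<^sup>* u X v\<close>. \<open>Dead\<close> has no productions; it blocks a marker outside the path
  to the one marker of a marked word.
\<close>

datatype 'n inverted = Dead | Old 'n | Context 'n | Start

primrec unmark_sym :: "('n, 't option) sym \<Rightarrow> ('n inverted, 't) sym" where
  "unmark_sym (Nt X) = Nt (Old X)"
| "unmark_sym (Tm t) = (case t of None \<Rightarrow> Nt Dead | Some a \<Rightarrow> Tm a)"

text \<open>
  The derivation tree of a marked word is turned upside down along the path from its root to the
  leaf with the marker. This leaf becomes the root. At a node of the path, what lies to the right of
  the path is now read first and what lies to its left is read last, with the part of the tree above
  the node in between; at the old root this part is empty.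
\<close>

definition invert_prods :: "('n, 't option) prods \<Rightarrow> 'n \<Rightarrow> ('n inverted, 't) prods" where
  "invert_prods P S =
    {(Old X, map unmark_sym \<alpha>) | X \<alpha>. (X, \<alpha>) \<in> P} \<union>
    {(Context S, [])} \<union>
    {(Context Y, map unmark_sym \<beta> @ [Nt (Context X)] @ map unmark_sym \<alpha>) | X \<alpha> Y \<beta>.
      (X, \<alpha> @ [Nt Y] @ \<beta>) \<in> P} \<union>
    {(Start, map unmark_sym \<beta> @ [Nt (Context X)] @ map unmark_sym \<alpha>) | X \<alpha> \<beta>.
      (X, \<alpha> @ [Tm None] @ \<beta>) \<in> P}"

lemma finite_invert_prods:
  assumes "finite P"
  shows "finite (invert_prods P S)"
proof -
  define pos where "pos = (SIGMA p:P. {..<length (snd p)})"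
  define f :: "('a \<times> ('a, 'b option) sym list) \<times> nat \<Rightarrow> 'a inverted \<times> ('a inverted, 'b) sym list"
    where "f = (\<lambda>((X, \<gamma>), i). (case \<gamma> ! i of Nt Y \<Rightarrow> Context Y | Tm t \<Rightarrow> Start,
      map unmark_sym (drop (Suc i) \<gamma>) @ [Nt (Context X)] @ map unmark_sym (take i \<gamma>)))"
  have "finite pos" using assms by (simp add: pos_def)
  moreover have "{(Context Y, map unmark_sym \<beta> @ [Nt (Context X)] @ map unmark_sym \<alpha>) | X \<alpha> Y \<beta>.
      (X, \<alpha> @ [Nt Y] @ \<beta>) \<in> P} \<subseteq> f ` pos"
  proof safe
    fix X \<alpha> Y \<beta> assume "(X, \<alpha> @ [Nt Y] @ \<beta>) \<in> P"
    then have "((X, \<alpha> @ [Nt Y] @ \<beta>), length \<alpha>) \<in> pos" by (simp add: pos_def)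
    from imageI[OF this, of f]
    show "(Context Y, map unmark_sym \<beta> @ [Nt (Context X)] @ map unmark_sym \<alpha>) \<in> f ` pos"
      by (simp add: f_def nth_append)
  qed
  moreover have "{(Start, map unmark_sym \<beta> @ [Nt (Context X)] @ map unmark_sym \<alpha>) | X \<alpha> \<beta>.
      (X, \<alpha> @ [Tm None] @ \<beta>) \<in> P} \<subseteq> f ` pos"
  proof safe
    fix X \<alpha> \<beta> assume "(X, \<alpha> @ [Tm None] @ \<beta>) \<in> P"
    then have "((X, \<alpha> @ [Tm None] @ \<beta>), length \<alpha>) \<in> pos" by (simp add: pos_def)
    from imageI[OF this, of f]
    show "(Start, map unmark_sym \<beta> @ [Nt (Context X)] @ map unmark_sym \<alpha>) \<in> f ` pos"
      by (simp add: f_def nth_append)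
  qed
  moreover have "{(Old X, map unmark_sym \<alpha>) | X \<alpha>. (X, \<alpha>) \<in> P}
      \<subseteq> (\<lambda>(X, \<alpha>). (Old X, map unmark_sym \<alpha>)) ` P"
    by force
  ultimately show ?thesis
    unfolding invert_prods_def finite_Un using assms
    by (intro conjI) (rule finite_subset, assumption, simp | simp)+
qed

lemma yields_Old:
  "yields P \<gamma> z \<Longrightarrow> z = map Some w \<Longrightarrow> yields (invert_prods P S) (map unmark_sym \<gamma>) w"
proof (induction arbitrary: w rule: yields.induct)
  case yields_Nil
  then show ?case by (simp add: yields.yields_Nil)
next
  case (yields_Tm \<gamma> z t)
  then obtain a w' where "t = Some a" "w = a # w'" "z = map Some w'" by (cases w) auto
  then show ?case using yields_Tm.IH by (simp add: yields.yields_Tm)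
next
  case (yields_Nt X \<delta> u \<gamma> v)
  then obtain x y where w: "w = x @ y" "u = map Some x" "v = map Some y"
    by (metis map_eq_append_conv)
  have "(Old X, map unmark_sym \<delta>) \<in> invert_prods P S"
    using yields_Nt.hyps by (auto simp: invert_prods_def)
  from yields.yields_Nt[OF this yields_Nt.IH(1)[OF w(2)] yields_Nt.IH(2)[OF w(3)]]
  show ?case by (simp add: w)
qed

text \<open>
  An induction over the derivation tree of a suffix \<open>\<gamma>\<close> of a right-hand side, down the path to the
  marker. The word \<open>d\<close> of the prefix \<open>\<delta>\<close> and the inverted word \<open>c\<close> of the surroundings of \<open>X\<close>
  are carried along, so that each step of the path applies one inverted production.
\<close>

lemma yields_Start:
  assumes "yields P \<gamma> z" "z = mark u v" "(X, \<delta> @ \<gamma>) \<in> P"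
    "yields (invert_prods P S) (map unmark_sym \<delta>) d"
    "yields (invert_prods P S) [Nt (Context X)] c"
  shows "yields (invert_prods P S) [Nt Start] (v @ c @ d @ u)"
  using assms
proof (induction arbitrary: u v X \<delta> d c rule: yields.induct)
  case yields_Nil
  then show ?case by (simp add: mark_def)
next
  case (yields_Tm \<gamma> z t)
  from yields_Tm.prems(1) have "mark u v = t # z" by simp
  then consider "t = None" "u = []" "z = map Some v"
    | a u' where "t = Some a" "u = a # u'" "z = mark u' v"
    unfolding mark_eq_Cons by blast
  then show ?case
  proof cases
    case 1
    have "(Start, map unmark_sym \<gamma> @ [Nt (Context X)] @ map unmark_sym \<delta>) \<in> invert_prods P S"
      using yields_Tm.prems(2) 1 by (force simp: invert_prods_def)
    moreover have "yields (invert_prods P S)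
        (map unmark_sym \<gamma> @ [Nt (Context X)] @ map unmark_sym \<delta>) (v @ c @ d)"
      by (intro yields_append yields_Old[OF yields_Tm.hyps 1(3)] yields_Tm.prems)
    ultimately show ?thesis using 1 by (auto simp: yields_single_Nt)
  next
    case 2
    have "yields (invert_prods P S) (map unmark_sym [Tm t]) [a]"
      using 2 yields_map_Tm[of _ "[a]"] by simp
    from yields_append[OF yields_Tm.prems(3) this]
    have "yields (invert_prods P S) (map unmark_sym (\<delta> @ [Tm t])) (d @ [a])" by simp
    with yields_Tm.IH[OF 2(3) _ this yields_Tm.prems(4)] yields_Tm.prems(2) 2
    show ?thesis by simp
  qed
next
  case (yields_Nt Y \<delta>' x \<gamma> y)
  from yields_Nt.prems(1)[symmetric] show ?case
  proof (cases rule: mark_eq_append)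
    case (left v' v'')
    have "(Context Y, map unmark_sym \<gamma> @ [Nt (Context X)] @ map unmark_sym \<delta>) \<in> invert_prods P S"
      using yields_Nt.prems(2) by (force simp: invert_prods_def)
    moreover have "yields (invert_prods P S)
        (map unmark_sym \<gamma> @ [Nt (Context X)] @ map unmark_sym \<delta>) (v'' @ c @ d)"
      by (intro yields_append yields_Old[OF yields_Nt.hyps(3) left(3)] yields_Nt.prems)
    ultimately have "yields (invert_prods P S) [Nt (Context Y)] (v'' @ c @ d)"
      by (auto simp: yields_single_Nt)
    with yields_Nt.IH(1)[OF left(2), of Y "[]" "[]" "v'' @ c @ d"] yields_Nt.hyps(1) left(1)
    show ?thesis by (simp add: yields_Nil)
  next
    case (right u' u'')
    have "yields P [Nt Y] x" using yields_Nt.hyps by (auto simp: yields_single_Nt)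
    from yields_append[OF yields_Nt.prems(3) yields_Old[OF this right(2)]]
    have "yields (invert_prods P S) (map unmark_sym (\<delta> @ [Nt Y])) (d @ u')" by simp
    with yields_Nt.IH(2)[OF right(3) _ this yields_Nt.prems(4)] yields_Nt.prems(2) right(1)
    show ?thesis by simp
  qed
qed

lemma yields_replace:
  assumes "(X, \<alpha> @ [s] @ \<beta>) \<in> P" "yields P \<alpha> u" "yields P \<beta> v" "yields P [s] z"
  shows "yields P [Nt X] (u @ z @ v)"
proof -
  have "yields P (\<alpha> @ [s] @ \<beta>) (u @ z @ v)" by (intro yields_append assms)
  then show ?thesis using assms(1) by (auto simp: yields_single_Nt)
qed

text \<open>
  This is the closure of context-free languages under cyclic shifts, with the cut at the marker.
\<close>

theorem context_free_inside_out:
  assumes "context_free K"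
  shows "context_free {v @ u | u v. mark u v \<in> K}"
proof -
  obtain P :: "(nat, 'a option) prods" and S where P: "finite P" and K: "K = cfg_lang P S"
    using assms unfolding context_free_def by blast
  define Q where "Q = invert_prods P S"
  define I where "I = (\<lambda>n. case n of
      Dead \<Rightarrow> {}
    | Old X \<Rightarrow> {w. yields P [Nt X] (map Some w)}
    | Context X \<Rightarrow> {v @ u | u v. \<forall>z. yields P [Nt X] z \<longrightarrow>
        yields P [Nt S] (map Some u @ z @ map Some v)}
    | Start \<Rightarrow> {v @ u | u v. yields P [Nt S] (mark u v)})"
  have old: "yields P \<gamma> (map Some w)" if "w \<in> conc I (map unmark_sym \<gamma>)" for \<gamma> w
    using that
  proof (induction \<gamma> arbitrary: w)
    case Nil
    then show ?case by (simp add: yields_Nil)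
  next
    case (Cons s \<gamma>)
    then obtain x y where w: "w = x @ y" "yields P \<gamma> (map Some y)"
      and x: "x \<in> sym_lang I (unmark_sym s)" by auto
    have "yields P [s] (map Some x)"
      using x yields_map_Tm[of P "[_]"]
      by (cases s) (auto simp: I_def split: option.splits)
    from yields_append[OF this w(2)] show ?case by (simp add: w)
  qed
  have closed: "conc I \<alpha> \<subseteq> I X" if "(X, \<alpha>) \<in> Q" for X \<alpha>
  proof
    fix w assume w: "w \<in> conc I \<alpha>"
    have split: "\<exists>b a u v. w = b @ (v @ u) @ a \<and> yields P \<alpha>' (map Some a)
        \<and> yields P \<beta>' (map Some b) \<and> (\<forall>z. yields P [Nt X'] z \<longrightarrow>
        yields P [Nt S] (map Some u @ z @ map Some v))"
      if \<alpha>: "\<alpha> = map unmark_sym \<beta>' @ [Nt (Context X')] @ map unmark_sym \<alpha>'" for \<beta>' \<alpha>' X'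
    proof -
      obtain b c a where "w = b @ c @ a" "b \<in> conc I (map unmark_sym \<beta>')"
        "a \<in> conc I (map unmark_sym \<alpha>')" "c \<in> I (Context X')"
        using w unfolding \<alpha> conc_append by auto
      moreover then obtain u v where "c = v @ u" "\<forall>z. yields P [Nt X'] z \<longrightarrow>
        yields P [Nt S] (map Some u @ z @ map Some v)"
        by (auto simp: I_def)
      ultimately show ?thesis using old by blast
    qed
    from that consider
        (Old) Y \<delta> where "X = Old Y" "\<alpha> = map unmark_sym \<delta>" "(Y, \<delta>) \<in> P"
      | (Root) "X = Context S" "\<alpha> = []"
      | (Context) X' \<alpha>' Y \<beta>' where "X = Context Y" "(X', \<alpha>' @ [Nt Y] @ \<beta>') \<in> P"
          "\<alpha> = map unmark_sym \<beta>' @ [Nt (Context X')] @ map unmark_sym \<alpha>'"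
      | (Start) X' \<alpha>' \<beta>' where "X = Start" "(X', \<alpha>' @ [Tm None] @ \<beta>') \<in> P"
          "\<alpha> = map unmark_sym \<beta>' @ [Nt (Context X')] @ map unmark_sym \<alpha>'"
      unfolding Q_def invert_prods_def by blast
    then show "w \<in> I X"
    proof cases
      case Old
      with old w show ?thesis by (auto simp: I_def yields_single_Nt)
    next
      case Root
      with w show ?thesis by (auto simp: I_def)
    next
      case Context
      from split[OF Context(3)] obtain b a u v where w': "w = b @ (v @ u) @ a"
        and ab: "yields P \<alpha>' (map Some a)" "yields P \<beta>' (map Some b)"
        and uv: "\<And>z. yields P [Nt X'] z \<Longrightarrow> yields P [Nt S] (map Some u @ z @ map Some v)"
        by blast
      have "yields P [Nt S] (map Some (u @ a) @ z @ map Some (b @ v))" if "yields P [Nt Y] z" for z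
        using uv[OF yields_replace[OF Context(2) ab that]] by simp
      moreover have "w = (b @ v) @ (u @ a)" using w' by simp
      ultimately show ?thesis unfolding Context(1) I_def inverted.case by blast
    next
      case Start
      from split[OF Start(3)] obtain b a u v where w': "w = b @ (v @ u) @ a"
        and ab: "yields P \<alpha>' (map Some a)" "yields P \<beta>' (map Some b)"
        and uv: "\<And>z. yields P [Nt X'] z \<Longrightarrow> yields P [Nt S] (map Some u @ z @ map Some v)"
        by blast
      have "yields P [Nt S] (mark (u @ a) (b @ v))"
        using uv[OF yields_replace[OF Start(2) ab, of "[None]"]] yields_map_Tm[of P "[None]"]
        by (simp add: mark_def)
      moreover have "w = (b @ v) @ (u @ a)" using w' by simp
      ultimately show ?thesis unfolding Start(1) I_def inverted.case by blast
    qed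
  qed
  have "yields Q [Nt Start] (v @ u)" if "yields P [Nt S] (mark u v)" for u v
  proof -
    obtain \<gamma> where \<gamma>: "(S, [] @ \<gamma>) \<in> P" "yields P \<gamma> (mark u v)"
      using \<open>yields P [Nt S] (mark u v)\<close> by (auto simp: yields_single_Nt)
    have "(Context S, []) \<in> invert_prods P S" by (simp add: invert_prods_def)
    then have "yields (invert_prods P S) [Nt (Context S)] []"
      unfolding yields_single_Nt using yields_Nil by blast
    from yields_Start[OF \<gamma>(2) refl \<gamma>(1) _ this, of "[]"] show ?thesis
      by (simp add: Q_def yields_Nil)
  qed
  moreover have "\<exists>u v. w = v @ u \<and> yields P [Nt S] (mark u v)" if "yields Q [Nt Start] w" for w
    using yields_subset_conc[OF closed that] by (auto simp: I_def)
  ultimately have "{v @ u | u v. mark u v \<in> K} = cfg_lang Q Start"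
    unfolding K cfg_lang_yields by blast
  then show ?thesis
    using context_free_cfg_lang[OF finite_invert_prods[OF P]] by (metis Q_def)
qed

section \<open>Permutation automata and their levels\<close>

text \<open>
  A complete graph as an action: letters act as permutations of \<open>V\<close>, the inverse letter by the
  inverse permutation, and all states are reached from the root \<open>x0\<close>.
\<close>

locale permutation_automaton = involutive_alphabet A ainv
  for A :: "'a set" and ainv :: "'a \<Rightarrow> 'a" +
  fixes V :: "'v set" and step :: "'v \<Rightarrow> 'a \<Rightarrow> 'v" and x0 :: 'v
  assumes step_closed: "\<lbrakk>p \<in> V; a \<in> A\<rbrakk> \<Longrightarrow> step p a \<in> V"
    and step_ainv: "\<lbrakk>p \<in> V; a \<in> A\<rbrakk> \<Longrightarrow> step (step p a) (ainv a) = p"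
    and root_in: "x0 \<in> V"
    and reachable_root: "p \<in> V \<Longrightarrow> \<exists>w\<in>lists A. foldl step x0 w = p"
begin

abbreviation run :: "'v \<Rightarrow> 'a list \<Rightarrow> 'v" where
  "run \<equiv> foldl step"

abbreviation inverse_word :: "'a list \<Rightarrow> 'a list" where
  "inverse_word w \<equiv> rev (map ainv w)"

lemma run_closed: "\<lbrakk>p \<in> V; w \<in> lists A\<rbrakk> \<Longrightarrow> run p w \<in> V"
  by (induction w arbitrary: p) (auto simp: step_closed)

lemma inverse_word_in: "w \<in> lists A \<Longrightarrow> inverse_word w \<in> lists A"
  using ainv_closed by (auto simp: in_lists_conv_set)

lemma inverse_word_inverse: "w \<in> lists A \<Longrightarrow> inverse_word (inverse_word w) = w"
  by (induction w) (auto simp: rev_map ainv_ainv)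

lemma run_inverse_word: "\<lbrakk>p \<in> V; w \<in> lists A\<rbrakk> \<Longrightarrow> run (run p w) (inverse_word w) = p"
  by (induction w arbitrary: p) (auto simp: step_closed step_ainv)

lemma run_inj: "\<lbrakk>p \<in> V; q \<in> V; w \<in> lists A; run p w = run q w\<rbrakk> \<Longrightarrow> p = q"
  by (metis run_inverse_word)

definition level :: "'v \<Rightarrow> nat" where
  "level p = (LEAST n. \<exists>w\<in>lists A. length w = n \<and> run x0 w = p)"

lemma geodesic:
  assumes "p \<in> V"
  obtains w where "w \<in> lists A" "length w = level p" "run x0 w = p"
proof -
  have "\<exists>n. \<exists>w\<in>lists A. length w = n \<and> run x0 w = p" using reachable_root[OF assms] by blast
  from LeastI_ex[OF this] show ?thesis using that unfolding level_def by blast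
qed

lemma level_le: "w \<in> lists A \<Longrightarrow> level (run x0 w) \<le> length w"
  unfolding level_def by (rule Least_le) blast

lemma level_root: "level x0 = 0"
  using level_le[of "[]"] by simp

lemma level_run: "\<lbrakk>p \<in> V; w \<in> lists A\<rbrakk> \<Longrightarrow> level (run p w) \<le> level p + length w"
proof -
  assume p: "p \<in> V" and w: "w \<in> lists A"
  obtain u where u: "u \<in> lists A" "length u = level p" "run x0 u = p" using geodesic[OF p] .
  then show ?thesis using level_le[of "u @ w"] w by simp
qed

lemma level_run': "\<lbrakk>p \<in> V; w \<in> lists A\<rbrakk> \<Longrightarrow> level p \<le> level (run p w) + length w"
  using level_run[of "run p w" "inverse_word w"] run_closed inverse_word_in
  by (simp add: run_inverse_word)

lemma level_step: "\<lbrakk>p \<in> V; a \<in> A\<rbrakk> \<Longrightarrow> level (step p a) \<le> Suc (level p)"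
  using level_run[of p "[a]"] by simp

lemma level_step': "\<lbrakk>p \<in> V; a \<in> A\<rbrakk> \<Longrightarrow> level p \<le> Suc (level (step p a))"
  using level_run'[of p "[a]"] by simp

section \<open>Walks above a level\<close>

primrec above :: "nat \<Rightarrow> 'v \<Rightarrow> 'a list \<Rightarrow> bool" where
  "above n p [] \<longleftrightarrow> n \<le> level p"
| "above n p (a # w) \<longleftrightarrow> n \<le> level p \<and> above n (step p a) w"

lemma above_append: "above n p (u @ v) \<longleftrightarrow> above n p u \<and> above n (run p u) v"
  by (induction u arbitrary: p) (auto, (metis above.simps neq_Nil_conv)+)

lemma above_start: "above n p w \<Longrightarrow> n \<le> level p"
  by (cases w) auto

lemma above_end: "above n p w \<Longrightarrow> n \<le> level (run p w)"
  using above_append[of n p w "[]"] by simp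

lemma above_mono: "\<lbrakk>above n p w; m \<le> n\<rbrakk> \<Longrightarrow> above m p w"
  by (induction w arbitrary: p) auto

lemma above_inverse_word:
  "\<lbrakk>p \<in> V; w \<in> lists A; above n p w\<rbrakk> \<Longrightarrow> above n (run p w) (inverse_word w)"
proof (induction w arbitrary: p)
  case (Cons a w)
  then have "above n (run (step p a) w) (inverse_word w)" by (simp add: step_closed)
  with Cons.prems show ?case
    by (auto simp: above_append run_inverse_word step_closed step_ainv dest: above_start)
qed simp

text \<open>
  A letter changes the level by at most one. A walk that gets below level \<open>n\<close> therefore does so for
  the first time from a state of level exactly \<open>n\<close>.
\<close>

lemma first_descent:
  assumes "p \<in> V" "w \<in> lists A" "n \<le> level p"
  shows "above n p w \<or> (\<exists>u a v. w = u @ a # v \<and> above n p u \<and> level (run p u) = n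
    \<and> Suc (level (step (run p u) a)) = n)"
  using assms
proof (induction w arbitrary: p)
  case (Cons a w)
  show ?case
  proof (cases "n \<le> level (step p a)")
    case True
    then consider "above n (step p a) w" | u b v where "w = u @ b # v" "above n (step p a) u"
      "level (run (step p a) u) = n" "Suc (level (step (run (step p a) u) b)) = n"
      using Cons.IH[of "step p a"] Cons.prems step_closed by auto
    then show ?thesis
    proof cases
      case 1
      then show ?thesis using Cons.prems by simp
    next
      case 2
      then have "a # w = (a # u) @ b # v \<and> above n p (a # u) \<and> level (run p (a # u)) = n
          \<and> Suc (level (step (run p (a # u)) b)) = n"
        using Cons.prems by simp
      then show ?thesis by blast
    qed
  next
    case False
    then have "level p = n \<and> Suc (level (step p a)) = n"
      using level_step'[of p a] Cons.prems by auto
    then have "a # w = [] @ a # w \<and> above n p [] \<and> level (run p []) = n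
        \<and> Suc (level (step (run p []) a)) = n" by simp
    then show ?thesis by blast
  qed
qed simp

lemma last_ascent:
  assumes "p \<in> V" "w \<in> lists A" "n \<le> level (run p w)"
  shows "above n p w \<or> (\<exists>u a v. w = u @ a # v \<and> above n (step (run p u) a) v
    \<and> Suc (level (run p u)) = n \<and> level (step (run p u) a) = n)"
  using assms
proof (induction w arbitrary: p)
  case (Cons a w)
  then consider "above n (step p a) w"
    | u b v where "w = u @ b # v" "above n (step (run (step p a) u) b) v"
      "Suc (level (run (step p a) u)) = n" "level (step (run (step p a) u) b) = n"
    using Cons.IH[OF step_closed[of p a]] Cons.prems by (auto simp del: in_lists_conv_set)
  then show ?case
  proof cases
    case 1
    show ?thesis
    proof (cases "n \<le> level p")
      case True
      with 1 show ?thesis by simp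
    next
      case False
      then have "a # w = [] @ a # w \<and> above n (step (run p []) a) w
          \<and> Suc (level (run p [])) = n \<and> level (step (run p []) a) = n"
        using 1 above_start[OF 1] level_step[of p a] Cons.prems by simp
      then show ?thesis by blast
    qed
  next
    case 2
    then have "a # w = (a # u) @ b # v \<and> above n (step (run p (a # u)) b) v
        \<and> Suc (level (run p (a # u))) = n \<and> level (step (run p (a # u)) b) = n"
      by simp
    then show ?thesis by blast
  qed
qed simp

text \<open>
  Four kinds of languages describe the part of the graph above a level. The languages
  \<open>returns p q\<close> are used for states of equal level. A word of \<open>separations p q\<close> records a walk
  from \<open>p\<close> up to some \<open>s\<close>, then, behind the marker, a walk from some \<open>r \<noteq> s\<close> down to \<open>q\<close>: it
  witnesses that \<open>s\<close> and \<open>r\<close> are different.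
\<close>

definition walks :: "nat \<Rightarrow> 'v \<Rightarrow> 'v \<Rightarrow> 'a list set" where
  "walks n p q = {w \<in> lists A. above n p w \<and> run p w = q}"

abbreviation "returns p q \<equiv> walks (level p) p q"

definition departures :: "'v \<Rightarrow> 'a list set" where
  "departures p = {w \<in> lists A. above (level p) p w}"

definition arrivals :: "'v \<Rightarrow> 'a list set" where
  "arrivals q = (\<Union>r\<in>V. walks (level q) r q)"

definition separations :: "'v \<Rightarrow> 'v \<Rightarrow> 'a option list set" where
  "separations p q = {mark u v | u v. u \<in> departures p \<and>
    (\<exists>r\<in>V. v \<in> walks (level q) r q \<and> r \<noteq> run p u)}"

lemma arrivals_eq: "q \<in> V \<Longrightarrow> arrivals q = inverse_word ` departures q"
proof (intro equalityI subsetI)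
  fix w assume q: "q \<in> V" and "w \<in> arrivals q"
  then obtain r where r: "r \<in> V" "w \<in> lists A" "above (level q) r w" "run r w = q"
    by (auto simp: arrivals_def walks_def)
  then have "inverse_word w \<in> departures q"
    using above_inverse_word[OF r(1-3)] inverse_word_in by (simp add: departures_def)
  then show "w \<in> inverse_word ` departures q"
    using inverse_word_inverse[OF r(2)] by force
next
  fix w assume q: "q \<in> V" and "w \<in> inverse_word ` departures q"
  then obtain u where u: "w = inverse_word u" "u \<in> lists A" "above (level q) q u"
    by (auto simp: departures_def)
  then show "w \<in> arrivals q"
    using above_inverse_word[OF q u(2,3)] run_closed[OF q u(2)] inverse_word_in[OF u(2)]
      run_inverse_word[OF q u(2)]
    unfolding arrivals_def walks_def by blast
qed

text \<open>
  Two walks into the same state under the same word start in the same state. So the two walks of a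
  marked word meet in one state exactly if their concatenation leads from \<open>p\<close> to \<open>q\<close>, and the
  separations are determined by three languages alone.
\<close>

lemma separations_eq:
  assumes "p \<in> V" "q \<in> V" "level q = level p"
  shows "separations p q =
    {mark u v | u v. u \<in> departures p \<and> v \<in> arrivals q \<and> u @ v \<notin> returns p q}"
proof -
  have "(\<exists>r\<in>V. v \<in> walks (level q) r q \<and> r \<noteq> run p u) \<longleftrightarrow>
    v \<in> arrivals q \<and> u @ v \<notin> returns p q" if u: "u \<in> departures p" for u v
  proof
    assume "\<exists>r\<in>V. v \<in> walks (level q) r q \<and> r \<noteq> run p u"
    then obtain r where r: "r \<in> V" "v \<in> walks (level q) r q" "r \<noteq> run p u" by blast
    then have "run (run p u) v \<noteq> q"
      using run_inj[of "run p u" r v] run_closed[OF assms(1)] u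
      by (auto simp: walks_def departures_def)
    then show "v \<in> arrivals q \<and> u @ v \<notin> returns p q"
      using r by (auto simp: arrivals_def walks_def)
  next
    assume v: "v \<in> arrivals q \<and> u @ v \<notin> returns p q"
    then obtain r where r: "r \<in> V" "v \<in> walks (level q) r q" by (auto simp: arrivals_def)
    moreover have "r \<noteq> run p u"
      using r v u assms(3) by (auto simp: walks_def departures_def above_append)
    ultimately show "\<exists>r\<in>V. v \<in> walks (level q) r q \<and> r \<noteq> run p u" by blast
  qed
  then show ?thesis unfolding separations_def by blast
qed

section \<open>Finitely many languages of walks\<close>

text \<open>
  The geometric core. Let \<open>\<alpha> w \<beta>\<close> be derived from a form all of whose words lead from \<open>x\<close> to
  \<open>y\<close>, where \<open>\<alpha>\<close> and \<open>\<beta>\<close> are short enough to be geodesic towards the level \<open>n\<close> of \<open>w\<close>. Descend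
  in the derivation tree as long as \<open>w\<close> belongs to a single subtree, and stop at the form where it
  is first cut. The cut is a state on the walk of \<open>w\<close>, hence of level at least \<open>n\<close>. It is reached
  from \<open>x\<close> also by a shortest word of the subform on the left, of length at most \<open>K\<close>, and so
  \<open>\<alpha>\<close> has by then lost all but at most \<open>K\<close> letters. The same holds on the right. Since all words
  of the form lead from \<open>x\<close> to \<open>y\<close>, every word that fits between what is left of \<open>\<alpha>\<close> and \<open>\<beta>\<close>
  acts on the starting state of \<open>w\<close> as \<open>w\<close> does.
\<close>

lemma bounded_factor:
  assumes rhs: "\<And>X \<delta>. (X, \<delta>) \<in> P \<Longrightarrow> \<delta> \<in> R"
    and suffix: "\<And>s \<gamma>. s # \<gamma> \<in> R \<Longrightarrow> \<gamma> \<in> R"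
    and short: "\<And>\<gamma> z. \<lbrakk>\<gamma> \<in> R; yields P \<gamma> z\<rbrakk> \<Longrightarrow> \<exists>v. yields P \<gamma> v \<and> length v \<le> K"
    and "yields P \<gamma> z" "\<gamma> \<in> R" "z = \<alpha> @ w @ \<beta>" "w \<noteq> []" "x \<in> V"
    and "\<And>v. yields P \<gamma> v \<Longrightarrow> v \<in> lists A \<and> run x v = y"
    and "level x + length \<alpha> \<le> n" "level y + length \<beta> \<le> n" "above n (run x \<alpha>) w"
  shows "\<exists>\<gamma>\<in>R. \<exists>\<alpha>'\<in>{u \<in> lists A. length u \<le> K}. \<exists>\<beta>'\<in>{u \<in> lists A. length u \<le> K}.
    yields P \<gamma> (\<alpha>' @ w @ \<beta>') \<and>
    (\<forall>v. yields P \<gamma> (\<alpha>' @ v @ \<beta>') \<longrightarrow> v \<in> lists A \<and> run (run x \<alpha>) v = run (run x \<alpha>) w)"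
  using assms(4-)
proof (induction arbitrary: \<alpha> w \<beta> x y rule: yields.induct)
  case yields_Nil
  then show ?case by simp
next
  case (yields_Tm \<gamma> z a)
  let ?\<gamma> = "Tm a # \<gamma>"
  have all: "a \<in> A" and zs: "v \<in> lists A" and runs: "run (step x a) v = y" if "yields P \<gamma> v" for v
    using yields_Tm.prems(5)[of "a # v"] that yields.yields_Tm[OF that, of a] by auto
  have a: "a \<in> A" using all yields_Tm.hyps .
  show ?case
  proof (cases \<alpha>)
    case (Cons b \<alpha>')
    then have \<alpha>: "\<alpha> = a # \<alpha>'" "z = \<alpha>' @ w @ \<beta>" using yields_Tm.prems(2) by auto
    have lev: "level (step x a) + length \<alpha>' \<le> n"
      using level_step[OF yields_Tm.prems(4) a] yields_Tm.prems(6) \<alpha> by simp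
    have run_\<alpha>: "run x \<alpha> = run (step x a) \<alpha>'" using \<alpha> by simp
    show ?thesis
      unfolding run_\<alpha>
    proof (rule yields_Tm.IH[OF suffix[OF yields_Tm.prems(1)] \<alpha>(2) yields_Tm.prems(3)
          step_closed[OF yields_Tm.prems(4) a] _ lev yields_Tm.prems(7)])
      show "above n (run (step x a) \<alpha>') w" using yields_Tm.prems(8) unfolding run_\<alpha> .
    next
      fix v assume "yields P \<gamma> v"
      then show "v \<in> lists A \<and> run (step x a) v = y" using zs runs by blast
    qed
  next
    case Nil
    then obtain w' where w: "w = a # w'" "z = w' @ \<beta>"
      using yields_Tm.prems(2,3) by (cases w) auto
    have zall: "\<alpha> @ w @ \<beta> \<in> lists A" "run x (\<alpha> @ w @ \<beta>) = y"
      using yields_Tm.prems(5)[of "a # z"] yields.yields_Tm[OF yields_Tm.hyps, of a]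
        yields_Tm.prems(2) by auto
    have "n \<le> level (step x a)"
      using yields_Tm.prems(8) w Nil above_start by auto
    moreover obtain v where "yields P \<gamma> v" "length v \<le> K"
      using short[OF suffix[OF yields_Tm.prems(1)] yields_Tm.hyps] by blast
    moreover from this have "level (step x a) \<le> level y + K"
      using level_run'[OF step_closed[OF yields_Tm.prems(4) a], of v] zs runs by simp
    ultimately have "length \<beta> \<le> K" using yields_Tm.prems(7) by linarith
    moreover have "v \<in> lists A \<and> run (run x \<alpha>) v = run (run x \<alpha>) w"
      if "yields P ?\<gamma> (\<alpha> @ v @ \<beta>)" for v
    proof -
      from yields_Tm.prems(5)[OF that] have v: "v \<in> lists A" "run x (v @ \<beta>) = y"
        using Nil by auto
      then have "run x v = run x w"
        using zall Nil run_inj[of "run x v" "run x w" \<beta>] run_closed yields_Tm.prems(4) by auto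
      with v Nil show ?thesis by simp
    qed
    moreover have "yields P ?\<gamma> (\<alpha> @ w @ \<beta>)"
      using yields.yields_Tm[OF yields_Tm.hyps, of a] w Nil by simp
    moreover have "\<alpha> \<in> lists A" "length \<alpha> \<le> K" "\<beta> \<in> lists A" using Nil zall by auto
    ultimately show ?thesis using yields_Tm.prems(1) by blast
  qed
next
  case (yields_Nt X \<delta> u \<gamma> v)
  let ?\<gamma> = "Nt X # \<gamma>"
  note x = yields_Nt.prems(4) and all = yields_Nt.prems(5) and uv = yields_Nt.prems(2)
  have both: "u' @ v' \<in> lists A" "run x (u' @ v') = y" if "yields P \<delta> u'" "yields P \<gamma> v'" for u' v'
    using all[of "u' @ v'"] yields.yields_Nt[OF yields_Nt.hyps(1) that] by auto
  have in_A: "u \<in> lists A" "v \<in> lists A" using both[OF yields_Nt.hyps(2,3)] by auto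
  from both[OF yields_Nt.hyps(2,3)] uv
  have in_A': "\<alpha> \<in> lists A" "w \<in> lists A" "\<beta> \<in> lists A" and y: "run x (\<alpha> @ w @ \<beta>) = y" by auto
  have xu: "run x u \<in> V" using run_closed[OF x in_A(1)] .
  have same: "run x u' = run x u" if "yields P \<delta> u'" for u'
    using both[OF that yields_Nt.hyps(3)] both[OF yields_Nt.hyps(2,3)]
      run_inj[of "run x u'" "run x u" v] run_closed[OF x] by auto
  \<comment> \<open>the end of the leftmost subtree falls into \<open>\<alpha>\<close>, into \<open>\<beta>\<close> or inside \<open>w\<close>\<close>
  consider (left) \<alpha>' where "\<alpha> = u @ \<alpha>'" "v = \<alpha>' @ w @ \<beta>"
    | (right) \<beta>' where "\<beta> = \<beta>' @ v" "u = \<alpha> @ w @ \<beta>'"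
    | (cut) w1 w2 where "w = w1 @ w2" "u = \<alpha> @ w1" "v = w2 @ \<beta>"
    using uv by (auto simp: append_eq_append_conv2)
  then show ?case
  proof cases
    case left
    have lev: "level (run x u) + length \<alpha>' \<le> n"
      using level_run[OF x in_A(1)] yields_Nt.prems(6) left by simp
    have run_\<alpha>: "run x \<alpha> = run (run x u) \<alpha>'" using left by simp
    show ?thesis
      unfolding run_\<alpha>
    proof (rule yields_Nt.IH(2)[OF suffix[OF yields_Nt.prems(1)] left(2) yields_Nt.prems(3) xu
          _ lev yields_Nt.prems(7)])
      show "above n (run (run x u) \<alpha>') w" using yields_Nt.prems(8) unfolding run_\<alpha> .
    next
      fix v' assume "yields P \<gamma> v'"
      then show "v' \<in> lists A \<and> run (run x u) v' = y"
        using both[OF yields_Nt.hyps(2)] by simp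
    qed
  next
    case right
    have "level (run x u) \<le> level y + length v"
      using level_run'[OF xu in_A(2)] both[OF yields_Nt.hyps(2,3)] by simp
    then have lev: "level (run x u) + length \<beta>' \<le> n"
      using yields_Nt.prems(7) right by simp
    show ?thesis
    proof (rule yields_Nt.IH(1)[OF rhs[OF yields_Nt.hyps(1)] right(2) yields_Nt.prems(3) x
          _ yields_Nt.prems(6) lev yields_Nt.prems(8)])
      fix u' assume "yields P \<delta> u'"
      then show "u' \<in> lists A \<and> run x u' = run x u"
        using both[OF _ yields_Nt.hyps(3)] same by simp
    qed
  next
    case cut
    have lev: "n \<le> level (run x u)"
      using yields_Nt.prems(8) cut by (simp add: above_append above_end)
    obtain u' where u': "yields P \<delta> u'" "length u' \<le> K"
      using short[OF rhs[OF yields_Nt.hyps(1)] yields_Nt.hyps(2)] by blast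
    then have "level (run x u) \<le> level x + K"
      using level_run[OF x, of u'] both[OF u'(1) yields_Nt.hyps(3)] same[OF u'(1)] by simp
    then have \<alpha>: "length \<alpha> \<le> K" using lev yields_Nt.prems(6) by linarith
    obtain v' where v': "yields P \<gamma> v'" "length v' \<le> K"
      using short[OF suffix[OF yields_Nt.prems(1)] yields_Nt.hyps(3)] by blast
    then have "level (run x u) \<le> level y + K"
      using level_run'[OF xu, of v'] both[OF yields_Nt.hyps(2) v'(1)] by simp
    then have \<beta>: "length \<beta> \<le> K" using lev yields_Nt.prems(7) by linarith
    have "t \<in> lists A \<and> run (run x \<alpha>) t = run (run x \<alpha>) w" if "yields P ?\<gamma> (\<alpha> @ t @ \<beta>)" for t
    proof -
      from all[OF that] have t: "t \<in> lists A" "run x (\<alpha> @ t @ \<beta>) = y" by auto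
      then have "run (run x \<alpha>) t = run (run x \<alpha>) w"
        using y in_A' run_inj[of "run (run x \<alpha>) t" "run (run x \<alpha>) w" \<beta>] run_closed x by auto
      with t show ?thesis by blast
    qed
    moreover have "yields P ?\<gamma> (\<alpha> @ w @ \<beta>)"
      using yields.yields_Nt[OF yields_Nt.hyps] uv by simp
    ultimately show ?thesis using \<alpha> \<beta> in_A'(1,3) yields_Nt.prems(1) by blast
  qed
qed

text \<open>
  There are finitely many sentential forms \<open>\<gamma>\<close> to consider and finitely many words of length at
  most \<open>K\<close>, whence finitely many languages \<open>{w. yields P \<gamma> (\<alpha> @ w @ \<beta>)}\<close>. They do not describe
  the walks above the level of \<open>p\<close> exactly, but they never confuse the target states.
\<close>

lemma finite_returns_cover:
  assumes "context_free {w \<in> lists A. run x0 w = x0}"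
  obtains \<F> where "finite \<F>"
    "\<And>p q w. \<lbrakk>p \<in> V; q \<in> V; level q = level p; w \<in> returns p q\<rbrakk> \<Longrightarrow>
      \<exists>F\<in>\<F>. w \<in> F \<and> F \<subseteq> {v \<in> lists A. run p v = q}"
proof -
  obtain P :: "(nat, 'a) prods" and S where P: "finite P"
    and L: "{w \<in> lists A. run x0 w = x0} = cfg_lang P S"
    using assms unfolding context_free_def by blast
  \<comment> \<open>the forms met while reading right-hand sides from left to right\<close>
  define R where "R = {\<gamma>. \<exists>\<delta>\<in>insert [Nt S] (snd ` P). \<exists>\<beta>. \<delta> = \<beta> @ \<gamma>}"
  have "R \<subseteq> (\<Union>\<delta>\<in>insert [Nt S] (snd ` P). (\<lambda>i. drop i \<delta>) ` {..length \<delta>})"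
  proof
    fix \<gamma> assume "\<gamma> \<in> R"
    then obtain \<delta> \<beta> where \<delta>: "\<delta> \<in> insert [Nt S] (snd ` P)" "\<delta> = \<beta> @ \<gamma>"
      unfolding R_def by blast
    then have "\<gamma> = drop (length \<beta>) \<delta>" "length \<beta> \<in> {..length \<delta>}" by auto
    with \<delta>(1) show "\<gamma> \<in> (\<Union>\<delta>\<in>insert [Nt S] (snd ` P). (\<lambda>i. drop i \<delta>) ` {..length \<delta>})" by blast
  qed
  then have R: "finite R" using P by (elim finite_subset) auto
  have start: "[Nt S] \<in> R" by (auto simp: R_def)
  have rhs: "\<delta> \<in> R" if "(X, \<delta>) \<in> P" for X \<delta>
    using that unfolding R_def by force
  have suffix: "\<gamma> \<in> R" if s: "s # \<gamma> \<in> R" for s \<gamma>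
  proof -
    obtain \<delta> \<beta> where \<delta>: "\<delta> \<in> insert [Nt S] (snd ` P)" and "\<delta> = \<beta> @ s # \<gamma>"
      using s unfolding R_def by blast
    then have "\<delta> = (\<beta> @ [s]) @ \<gamma>" by simp
    with \<delta> show ?thesis unfolding R_def by blast
  qed
  define short where "short = (\<lambda>\<gamma>. LEAST n. \<exists>v. yields P \<gamma> v \<and> length v = n)"
  \<comment> \<open>every productive form yields a word of at most this length\<close>
  define K where "K = Max (short ` R)"
  have short: "\<exists>v. yields P \<gamma> v \<and> length v \<le> K" if "\<gamma> \<in> R" "yields P \<gamma> z" for \<gamma> z
  proof -
    have "\<exists>n v. yields P \<gamma> v \<and> length v = n" using that by blast
    from LeastI_ex[OF this] obtain v where "yields P \<gamma> v" "length v = short \<gamma>"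
      unfolding short_def by blast
    moreover have "short \<gamma> \<le> K" unfolding K_def using R that by (intro Max_ge) auto
    ultimately show ?thesis by auto
  qed
  define W where "W = {u \<in> lists A. length u \<le> K}"
  have W: "finite W"
    using finite_lists_length_le[OF finite_alphabet, of K]
    by (rule rev_finite_subset) (auto simp: W_def in_lists_conv_set)
  define \<F> where "\<F> = insert {[]} ((\<lambda>(\<gamma>, \<alpha>, \<beta>). {w. yields P \<gamma> (\<alpha> @ w @ \<beta>)}) ` (R \<times> W \<times> W))"
  show thesis
  proof (rule that)
    show "finite \<F>" unfolding \<F>_def using R W by simp
    fix p q w
    assume p: "p \<in> V" and q: "q \<in> V" and lev: "level q = level p" and w: "w \<in> returns p q"
    show "\<exists>F\<in>\<F>. w \<in> F \<and> F \<subseteq> {v \<in> lists A. run p v = q}"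
    proof (cases "w = []")
      case True
      then show ?thesis using w by (intro bexI[of _ "{[]}"]) (auto simp: \<F>_def walks_def)
    next
      case False
      obtain \<alpha> where \<alpha>: "\<alpha> \<in> lists A" "length \<alpha> = level p" "run x0 \<alpha> = p"
        using geodesic[OF p] .
      obtain \<beta>' where \<beta>': "\<beta>' \<in> lists A" "length \<beta>' = level q" "run x0 \<beta>' = q"
        using geodesic[OF q] .
      define \<beta> where "\<beta> = inverse_word \<beta>'"
      have \<beta>: "\<beta> \<in> lists A" "length \<beta> = level q" "run q \<beta> = x0"
        using \<beta>' inverse_word_in run_inverse_word[OF root_in \<beta>'(1)] by (auto simp: \<beta>_def)
      have all: "v \<in> lists A \<and> run x0 v = x0" if "yields P [Nt S] v" for v
        using that L unfolding cfg_lang_yields by blast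
      have "\<alpha> @ w @ \<beta> \<in> {w \<in> lists A. run x0 w = x0}"
        using \<alpha> \<beta> w by (simp add: walks_def)
      then have "yields P [Nt S] (\<alpha> @ w @ \<beta>)" unfolding L cfg_lang_yields by blast
      have levels: "level x0 + length \<alpha> \<le> level p" "level x0 + length \<beta> \<le> level p"
        "above (level p) (run x0 \<alpha>) w"
        using \<alpha> \<beta> lev w level_root by (simp_all add: walks_def)
      have "\<exists>\<gamma>\<in>R. \<exists>\<alpha>'\<in>W. \<exists>\<beta>'\<in>W. yields P \<gamma> (\<alpha>' @ w @ \<beta>') \<and>
        (\<forall>v. yields P \<gamma> (\<alpha>' @ v @ \<beta>') \<longrightarrow>
          v \<in> lists A \<and> run (run x0 \<alpha>) v = run (run x0 \<alpha>) w)"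
        unfolding W_def
        by (rule bounded_factor[where P = P and x = x0 and y = x0 and n = "level p"
              and \<gamma> = "[Nt S]" and z = "\<alpha> @ w @ \<beta>" and \<beta> = \<beta>])
          (erule rhs | erule suffix | erule (1) short | erule all
            | rule \<open>yields P [Nt S] (\<alpha> @ w @ \<beta>)\<close> start refl False root_in levels)+
      then obtain \<gamma> \<alpha>' \<beta>' where *: "\<gamma> \<in> R" "\<alpha>' \<in> W" "\<beta>' \<in> W"
        "yields P \<gamma> (\<alpha>' @ w @ \<beta>')"
        "\<And>v. yields P \<gamma> (\<alpha>' @ v @ \<beta>') \<Longrightarrow> v \<in> lists A \<and> run p v = run p w"
        unfolding \<alpha>(3) by blast
      define F where "F = {v. yields P \<gamma> (\<alpha>' @ v @ \<beta>')}"
      have "F \<in> \<F>" unfolding F_def \<F>_def using *(1-3) by force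
      moreover have "w \<in> F" unfolding F_def using *(4) by blast
      moreover have "F \<subseteq> {v \<in> lists A. run p v = q}"
      proof
        fix v assume "v \<in> F"
        then have "v \<in> lists A" "run p v = run p w" unfolding F_def using *(5)[of v] by blast+
        then show "v \<in> {v \<in> lists A. run p v = q}" using w by (simp add: walks_def)
      qed
      ultimately show ?thesis by blast
    qed
  qed
qed

definition level_pairs :: "('v \<times> 'v) set" where
  "level_pairs = {(p, q). p \<in> V \<and> q \<in> V \<and> level q = level p}"

definition return_langs :: "'a list set set" where
  "return_langs = (\<lambda>(p, q). returns p q) ` level_pairs"

definition separation_langs :: "'a option list set set" where
  "separation_langs = (\<lambda>(p, q). separations p q) ` level_pairs"

text \<open>
  Let \<open>E p q\<close> be the union of those covering languages whose words all lead from \<open>p\<close> to \<open>q\<close>. It lies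
  between the walks above the level of \<open>p\<close> and all walks from \<open>p\<close> to \<open>q\<close>, and it takes finitely
  many values. A word starting at \<open>p\<close> leaves the part of the graph above the level of \<open>p\<close> if and
  only if it has a prefix in some \<open>E p q\<close> that is followed by a letter leading down from \<open>q\<close>. So
  \<open>departures p\<close> depends only on the set of pairs of a value \<open>E p q\<close> and such a letter, and there
  are finitely many such sets. The other three kinds of languages are computed from \<open>departures\<close>
  and \<open>E\<close>.
\<close>

lemma finite_langs:
  assumes "context_free {w \<in> lists A. run x0 w = x0}"
  shows "finite return_langs" "finite (departures ` V)" "finite (arrivals ` V)"
    "finite separation_langs"
proof -
  obtain \<F> where \<F>: "finite \<F>" and cover:
    "\<And>p q w. \<lbrakk>p \<in> V; q \<in> V; level q = level p; w \<in> returns p q\<rbrakk> \<Longrightarrow>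
      \<exists>F\<in>\<F>. w \<in> F \<and> F \<subseteq> {v \<in> lists A. run p v = q}"
    by (rule finite_returns_cover[OF assms]) (rule that)
  define E where "E p q = \<Union>{F \<in> \<F>. F \<subseteq> {v \<in> lists A. run p v = q}}" for p q
  have E_run: "v \<in> lists A" "run p v = q" if "v \<in> E p q" for p q v
    using that unfolding E_def by blast+
  have returns_E: "returns p q \<subseteq> E p q" if "(p, q) \<in> level_pairs" for p q
    using cover[of p q] that unfolding E_def level_pairs_def by blast
  define \<E> where "\<E> = Union ` Pow \<F>"
  have \<E>: "finite \<E>" "E p q \<in> \<E>" for p q using \<F> unfolding \<E>_def E_def by auto
  \<comment> \<open>the letters that lead below the level of \<open>p\<close>, with the walks after which they do so\<close>
  define exits where "exits p =
    {(E p q, a) | q a. (p, q) \<in> level_pairs \<and> a \<in> A \<and> level (step q a) < level p}" for p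
  define inside where "inside X = lists A - {u @ a # v | F u a v. (F, a) \<in> X \<and> u \<in> F}"
    for X :: "('a list set \<times> 'a) set"
  have departures_eq: "departures p = inside (exits p)" if p: "p \<in> V" for p
  proof (intro equalityI subsetI)
    fix w assume w: "w \<in> departures p"
    have False if "w = u @ a # v" "(F, a) \<in> exits p" "u \<in> F" for F u a v
    proof -
      obtain q where "u \<in> E p q" "level (step q a) < level p"
        using \<open>(F, a) \<in> exits p\<close> \<open>u \<in> F\<close> unfolding exits_def by blast
      moreover have "above (level p) p (u @ [a] @ v)"
        using w \<open>w = u @ a # v\<close> by (simp add: departures_def)
      then have "above (level p) (run p u) [a]" unfolding above_append by blast
      ultimately show False using E_run by auto
    qed
    then show "w \<in> inside (exits p)" using w unfolding inside_def departures_def by blast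
  next
    fix w assume w: "w \<in> inside (exits p)"
    then have "w \<in> lists A" by (simp add: inside_def)
    show "w \<in> departures p"
    proof (rule ccontr)
      assume "w \<notin> departures p"
      then have "\<not> above (level p) p w" using \<open>w \<in> lists A\<close> by (simp add: departures_def)
      then obtain u a v where uv: "w = u @ a # v" "above (level p) p u"
        "level (run p u) = level p" "Suc (level (step (run p u) a)) = level p"
        using first_descent[OF p \<open>w \<in> lists A\<close> order_refl] by blast
      have uA: "u \<in> lists A" "a \<in> A" using \<open>w \<in> lists A\<close> uv by auto
      have "(p, run p u) \<in> level_pairs"
        using p run_closed[OF p uA(1)] uv by (simp add: level_pairs_def)
      moreover from returns_E[OF this] have "u \<in> E p (run p u)"
        using uA uv by (auto simp: walks_def)
      moreover have "(E p (run p u), a) \<in> exits p"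
        using calculation(1) uA uv unfolding exits_def by auto
      ultimately show False using w uv unfolding inside_def by blast
    qed
  qed
  have "exits p \<in> Pow (\<E> \<times> A)" for p
    using \<E>(2) unfolding exits_def by blast
  then have "departures ` V \<subseteq> inside ` Pow (\<E> \<times> A)" using departures_eq by blast
  then show dep: "finite (departures ` V)"
    using \<E>(1) finite_alphabet by (elim finite_subset) simp
  have "arrivals ` V = (`) inverse_word ` departures ` V"
    using arrivals_eq by (simp add: image_image)
  then show arr: "finite (arrivals ` V)" using dep by simp
  have "returns p q = departures p \<inter> E p q" if "(p, q) \<in> level_pairs" for p q
    using returns_E[OF that] E_run by (auto simp: walks_def departures_def)
  then have "return_langs \<subseteq> (\<lambda>(D, F). D \<inter> F) ` (departures ` V \<times> \<E>)"
    using \<E>(2) unfolding return_langs_def level_pairs_def by fastforce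
  then show ret: "finite return_langs"
    using dep \<E>(1) by (elim finite_subset) simp
  \<comment> \<open>the formula of \<open>separations_eq\<close>\<close>
  define sep where "sep = (\<lambda>(D, C, N). {mark u v | u v. u \<in> D \<and> v \<in> C \<and> u @ v \<notin> (N :: 'a list set)})"
  have "separations p q = sep (departures p, arrivals q, returns p q)"
    if "(p, q) \<in> level_pairs" for p q
    using separations_eq that by (simp add: sep_def level_pairs_def)
  then have "separation_langs \<subseteq> sep ` (departures ` V \<times> arrivals ` V \<times> return_langs)"
    unfolding separation_langs_def return_langs_def level_pairs_def by force
  then show "finite separation_langs"
    using dep arr ret by (elim finite_subset) simp
qed

section \<open>Factoring the languages of walks\<close>

lemma departures_run: "departures p = (\<Union>s. walks (level p) p s)"
  by (auto simp: departures_def walks_def)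

definition sector_langs :: "'a option list set set" where
  "sector_langs = (`) (map Some) ` (return_langs \<union> departures ` V \<union> arrivals ` V) \<union> separation_langs"

text \<open>
  The bound 4 on the length of the patterns leaves room for a \<open>hop\<close>, defined next, and one
  further language.
\<close>

abbreviation "sector_factors \<equiv> factors_in (insert None (Some ` A)) 4 sector_langs"

text \<open>
  A nonempty walk \<open>h\<close> between states of equal level, together with a pattern \<open>H\<close> all of
  whose products lead from \<open>p\<close> to the same state \<open>q\<close>. There are two such patterns below: a letter
  that stays in the level, or a letter up, a walk above the next level, and a letter down.
\<close>

definition hop :: "'v \<Rightarrow> ('a option list set, 'a option) sym list \<Rightarrow> 'v \<Rightarrow> 'a list \<Rightarrow> bool" where
  "hop p H q h \<longleftrightarrow> q \<in> V \<and> level q = level p \<and> length H \<le> 3 \<and>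
    set H \<subseteq> Nt ` sector_langs \<union> Tm ` insert None (Some ` A) \<and> h \<noteq> [] \<and>
    map Some h \<in> conc (\<lambda>X. {v \<in> X. length v < length h}) H \<and>
    conc (\<lambda>X. X) H \<subseteq> map Some ` returns p q"

lemma hop_letter: "\<lbrakk>p \<in> V; a \<in> A; level (step p a) = level p\<rbrakk> \<Longrightarrow> hop p [Tm (Some a)] (step p a) [a]"
  by (auto simp: hop_def step_closed walks_def intro!: image_eqI[of _ _ "[a]"])

lemma hop_excursion:
  assumes "p \<in> V" "a \<in> A" "level (step p a) = Suc (level p)" "u \<in> returns (step p a) q"
    "level q = Suc (level p)" "b \<in> A" "level (step q b) = level p"
  shows "hop p [Tm (Some a), Nt (map Some ` returns (step p a) q), Tm (Some b)] (step q b) (a # u @ [b])"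
proof -
  have q: "q \<in> V" using assms(1,2,4) run_closed step_closed by (auto simp: walks_def)
  have "(step p a, q) \<in> level_pairs"
    using assms q by (simp add: level_pairs_def step_closed)
  then have "map Some ` returns (step p a) q \<in> sector_langs"
    unfolding sector_langs_def return_langs_def by blast
  moreover have "Some a # map Some v @ [Some b] \<in> map Some ` returns p (step q b)"
    if "v \<in> returns (step p a) q" for v
  proof (rule image_eqI)
    show "a # v @ [b] \<in> returns p (step q b)"
      using that assms above_mono[of "Suc (level p)" "step p a" v "level p"]
      by (auto simp: walks_def above_append)
  qed simp
  ultimately show ?thesis
    using assms q by (auto simp: hop_def step_closed)
qed

lemma walks_head:
  assumes "p \<in> V" "w \<in> walks (level p) p s"
  obtains (stay) "w = []" "s = p"
  | (hop) H q h v where "w = h @ v" "hop p H q h" "v \<in> walks (level q) q s"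
  | (ascend) a v where "w = a # v" "a \<in> A" "level (step p a) = Suc (level p)"
      "v \<in> walks (level (step p a)) (step p a) s"
proof (cases w)
  case Nil
  then show ?thesis using assms stay by (simp add: walks_def)
next
  case (Cons a v)
  with assms have a: "a \<in> A" "v \<in> lists A" "above (level p) (step p a) v" "run (step p a) v = s"
    by (auto simp: walks_def)
  let ?q = "step p a"
  have q: "?q \<in> V" using assms(1) a by (simp add: step_closed)
  have "level p \<le> level ?q" "level ?q \<le> Suc (level p)"
    using above_start[OF a(3)] level_step[OF assms(1) a(1)] by auto
  then consider "level ?q = level p" | "level ?q = Suc (level p)" by linarith
  then show ?thesis
  proof cases
    case 1
    show ?thesis
      by (rule hop[of "[a]" v "[Tm (Some a)]" ?q])
        (use Cons 1 a hop_letter[OF assms(1) a(1) 1] in \<open>auto simp: walks_def\<close>)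
  next
    case 2
    consider "above (level ?q) ?q v"
      | u b x where "v = u @ b # x" "above (level ?q) ?q u" "level (run ?q u) = level ?q"
        "Suc (level (step (run ?q u) b)) = level ?q"
      using first_descent[OF q a(2) order_refl] by blast
    then show ?thesis
    proof cases
      case 1
      show ?thesis by (rule ascend[of a v]) (use Cons a 1 2 in \<open>auto simp: walks_def\<close>)
    next
      case (2 u b x)
      let ?r = "run ?q u"
      have "u \<in> returns ?q ?r" using 2 a by (auto simp: walks_def)
      moreover have b: "b \<in> A" "level (step ?r b) = level p" "level ?r = Suc (level p)"
        using 2 a \<open>level ?q = Suc (level p)\<close> by auto
      ultimately have "hop p [Tm (Some a), Nt (map Some ` returns ?q ?r), Tm (Some b)]
          (step ?r b) (a # u @ [b])"
        using hop_excursion[OF assms(1) a(1) \<open>level ?q = Suc (level p)\<close>] by blast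
      moreover have "x \<in> walks (level (step ?r b)) (step ?r b) s"
        using a 2 b by (auto simp: walks_def above_append)
      ultimately show ?thesis using hop[of "a # u @ [b]" x] Cons 2 by simp
    qed
  qed
qed

lemma walks_last:
  assumes "r \<in> V" "w \<in> walks (level q) r q"
  obtains (stay) "w = []" "r = q"
  | (hop) H p h v where "w = v @ h" "p \<in> V" "hop p H q h" "v \<in> walks (level p) r p"
  | (descend) a v p where "w = v @ [a]" "a \<in> A" "p \<in> V" "step p a = q"
      "level p = Suc (level q)" "v \<in> walks (level p) r p"
proof (cases w rule: rev_cases)
  case Nil
  then show ?thesis using assms stay by (simp add: walks_def)
next
  case (snoc v a)
  let ?p = "run r v"
  from snoc assms have a: "a \<in> A" "v \<in> lists A" "above (level q) r v" "step ?p a = q"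
    by (auto simp: walks_def above_append)
  have p: "?p \<in> V" using run_closed[OF assms(1) a(2)] .
  have "level q \<le> level ?p" "level ?p \<le> Suc (level q)"
    using above_end[OF a(3)] level_step'[OF p a(1)] a(4) by auto
  then consider "level ?p = level q" | "level ?p = Suc (level q)" by linarith
  then show ?thesis
  proof cases
    case 1
    show ?thesis
      by (rule hop[of v "[a]" ?p "[Tm (Some a)]"])
        (use snoc 1 a p hop_letter[OF p a(1)] in \<open>auto simp: walks_def\<close>)
  next
    case 2
    consider "above (level ?p) r v"
      | x b u where "v = x @ b # u" "above (level ?p) (step (run r x) b) u"
        "Suc (level (run r x)) = level ?p" "level (step (run r x) b) = level ?p"
      using last_ascent[OF assms(1) a(2) order_refl] by blast
    then show ?thesis
    proof cases
      case 1
      show ?thesis by (rule descend[of v a ?p]) (use snoc a p 1 2 in \<open>auto simp: walks_def\<close>)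
    next
      case (2 x b u)
      let ?t = "run r x"
      have b: "b \<in> A" "x \<in> lists A" "u \<in> lists A" "run (step ?t b) u = ?p"
        using a 2 by auto
      have t: "?t \<in> V" using run_closed[OF assms(1) b(2)] .
      have lev: "level ?t = level q" "level (step ?t b) = Suc (level ?t)" "level ?p = Suc (level ?t)"
        using 2 \<open>level ?p = Suc (level q)\<close> by auto
      have "u \<in> returns (step ?t b) ?p"
        unfolding walks_def 2(4) using 2(2) b(3,4) by blast
      then have "hop ?t [Tm (Some b), Nt (map Some ` returns (step ?t b) ?p), Tm (Some a)]
          (step ?p a) (b # u @ [a])"
        using hop_excursion[OF t b(1) lev(2) _ lev(3) a(1)] a(4) lev(1) by simp
      moreover have "x \<in> walks (level ?t) r ?t"
        using a(3) 2(1) b lev by (simp add: walks_def above_append)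
      ultimately show ?thesis using hop[of x "b # u @ [a]" ?t] snoc 2(1) t a(4) by simp
    qed
  qed
qed

lemma conc_shorter: "m \<le> n \<Longrightarrow>
  conc (\<lambda>X. {v \<in> X. length v < m}) \<gamma> \<subseteq> conc (\<lambda>X. {v \<in> X. length v < n}) \<gamma>"
  by (rule conc_mono) auto

lemma factors_hop_left:
  assumes "hop p H q h" "X \<in> sector_langs" "z \<in> X"
    "\<And>u v. \<lbrakk>u \<in> returns p q; v \<in> X\<rbrakk> \<Longrightarrow> map Some u @ v \<in> L"
  shows "sector_factors (map Some h @ z) L"
  unfolding factors_in_def
proof (intro exI[of _ "H @ [Nt X]"] conjI)
  show "length (H @ [Nt X]) \<le> 4" "set (H @ [Nt X]) \<subseteq> Nt ` sector_langs \<union> Tm ` insert None (Some ` A)"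
    using assms by (auto simp: hop_def)
  show "map Some h @ z \<in> conc (\<lambda>X. {v \<in> X. length v < length (map Some h @ z)}) (H @ [Nt X])"
    using assms conc_shorter[of "length h" "length (map Some h @ z)" H]
    unfolding conc_append hop_def by fastforce
  show "conc (\<lambda>X. X) (H @ [Nt X]) \<subseteq> L"
    using assms unfolding conc_append hop_def by fastforce
qed

lemma factors_hop_right:
  assumes "hop p H q h" "X \<in> sector_langs" "z \<in> X"
    "\<And>u v. \<lbrakk>u \<in> returns p q; v \<in> X\<rbrakk> \<Longrightarrow> v @ map Some u \<in> L"
  shows "sector_factors (z @ map Some h) L"
  unfolding factors_in_def
proof (intro exI[of _ "[Nt X] @ H"] conjI)
  show "length ([Nt X] @ H) \<le> 4" "set ([Nt X] @ H) \<subseteq> Nt ` sector_langs \<union> Tm ` insert None (Some ` A)"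
    using assms by (auto simp: hop_def)
  show "z @ map Some h \<in> conc (\<lambda>X. {v \<in> X. length v < length (z @ map Some h)}) ([Nt X] @ H)"
    using assms conc_shorter[of "length h" "length (z @ map Some h)" H]
    unfolding conc_append hop_def by fastforce
  show "conc (\<lambda>X. X) ([Nt X] @ H) \<subseteq> L"
    using assms unfolding conc_append hop_def by fastforce
qed

lemma sector_langsI:
  "\<lbrakk>p \<in> V; q \<in> V; level q = level p\<rbrakk> \<Longrightarrow> map Some ` returns p q \<in> sector_langs"
  "p \<in> V \<Longrightarrow> map Some ` departures p \<in> sector_langs"
  "p \<in> V \<Longrightarrow> map Some ` arrivals p \<in> sector_langs"
  "\<lbrakk>p \<in> V; q \<in> V; level q = level p\<rbrakk> \<Longrightarrow> separations p q \<in> sector_langs"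
  by (auto simp: sector_langs_def return_langs_def separation_langs_def level_pairs_def)

lemma walks_append:
  "\<lbrakk>u \<in> walks n p q; v \<in> walks n q r\<rbrakk> \<Longrightarrow> u @ v \<in> walks n p r"
  by (auto simp: walks_def above_append)

lemma returns_departures: "\<lbrakk>u \<in> returns p q; level q = level p; v \<in> departures q\<rbrakk> \<Longrightarrow> u @ v \<in> departures p"
  unfolding departures_run using walks_append by fastforce

lemma arrivals_returns: "\<lbrakk>v \<in> arrivals p; level q = level p; u \<in> returns p q\<rbrakk> \<Longrightarrow> v @ u \<in> arrivals q"
  unfolding arrivals_def using walks_append by fastforce

lemma separations_left:
  "\<lbrakk>u \<in> returns p p'; level p' = level p; z \<in> separations p' q\<rbrakk> \<Longrightarrow> map Some u @ z \<in> separations p q"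
proof -
  assume u: "u \<in> returns p p'" "level p' = level p" and "z \<in> separations p' q"
  then obtain x y r where z: "z = mark x y" "x \<in> departures p'" "r \<in> V" "y \<in> walks (level q) r q"
    "r \<noteq> run p' x"
    unfolding separations_def by blast
  moreover have "map Some u @ z = mark (u @ x) y" by (simp add: z mark_def)
  moreover have "r \<noteq> run p (u @ x)" using u z(5) by (simp add: walks_def)
  ultimately show ?thesis
    using returns_departures[OF u z(2)] unfolding separations_def by blast
qed

lemma separations_right:
  "\<lbrakk>q \<in> V; q' \<in> V; u \<in> returns q' q; level q = level q'; z \<in> separations p q'\<rbrakk> \<Longrightarrow>
    z @ map Some u \<in> separations p q"
proof -
  assume q: "q \<in> V" "q' \<in> V" "u \<in> returns q' q" "level q = level q'" and "z \<in> separations p q'"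
  then obtain x y r where z: "z = mark x y" "x \<in> departures p" "r \<in> V"
    "y \<in> walks (level q') r q'" "r \<noteq> run p x"
    unfolding separations_def by blast
  moreover have "z @ map Some u = mark x (y @ u)" by (simp add: z mark_def)
  moreover have "y @ u \<in> walks (level q) r q" using z(4) q walks_append by metis
  ultimately show ?thesis unfolding separations_def by blast
qed

lemma departures_up:
  assumes "a \<in> A" "level (step p a) = Suc (level p)" "v \<in> departures (step p a)"
  shows "a # v \<in> departures p"
  using assms above_mono[of "Suc (level p)" "step p a" v "level p"] by (auto simp: departures_def)

lemma walks_down:
  assumes "a \<in> A" "step p a = q" "level p = Suc (level q)" "v \<in> walks (level p) r p"
  shows "v @ [a] \<in> walks (level q) r q"
  using assms above_mono[of "Suc (level q)" r v "level q"] by (auto simp: walks_def above_append)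

lemma factors_returns:
  assumes "(p, q) \<in> level_pairs" "w \<in> returns p q"
  shows "sector_factors (map Some w) (map Some ` returns p q)"
proof -
  have pq: "p \<in> V" "q \<in> V" "level q = level p" using assms by (auto simp: level_pairs_def)
  from pq(1) assms(2) show ?thesis
  proof (cases rule: walks_head)
    case stay
    then show ?thesis
      using assms(2) unfolding factors_in_def by (intro exI[of _ "[]"]) simp
  next
    case (hop H p' h v)
    have p': "p' \<in> V" "level p' = level p" using hop(2) by (auto simp: hop_def)
    have "sector_factors (map Some h @ map Some v) (map Some ` returns p q)"
    proof (rule factors_hop_left[OF hop(2)])
      show "map Some ` returns p' q \<in> sector_langs" using p' pq by (intro sector_langsI) auto
      show "map Some v \<in> map Some ` returns p' q" using hop(3) by simp
    next
      fix x y assume "x \<in> returns p p'" "y \<in> map Some ` returns p' q"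
      then show "map Some x @ y \<in> map Some ` returns p q"
        using walks_append[of x _ p p' _ q] p'(2) by (auto simp flip: map_append)
    qed
    then show ?thesis using hop(1) by simp
  next
    case (ascend a v)
    then have "Suc (level p) \<le> level q" using above_end by (auto simp: walks_def)
    then show ?thesis using pq by simp
  qed
qed

lemma factors_departures:
  assumes "p \<in> V" "w \<in> departures p"
  shows "sector_factors (map Some w) (map Some ` departures p)"
proof -
  obtain s where "w \<in> walks (level p) p s" using assms(2) unfolding departures_run by blast
  with assms(1) show ?thesis
  proof (cases rule: walks_head)
    case stay
    then show ?thesis
      using assms(2) unfolding factors_in_def by (intro exI[of _ "[]"]) simp
  next
    case (hop H p' h v)
    have p': "p' \<in> V" "level p' = level p" using hop(2) by (auto simp: hop_def)
    have "sector_factors (map Some h @ map Some v) (map Some ` departures p)"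
    proof (rule factors_hop_left[OF hop(2)])
      show "map Some ` departures p' \<in> sector_langs" using p' by (intro sector_langsI)
      show "map Some v \<in> map Some ` departures p'" using hop(3) unfolding departures_run by blast
    next
      fix x y assume "x \<in> returns p p'" "y \<in> map Some ` departures p'"
      then show "map Some x @ y \<in> map Some ` departures p"
        using returns_departures p'(2) by (auto simp flip: map_append)
    qed
    then show ?thesis using hop(1) by simp
  next
    case (ascend a v)
    have "v \<in> departures (step p a)" using ascend(4) unfolding departures_run by blast
    moreover have "Some a # map Some y \<in> map Some ` departures p"
      if "y \<in> departures (step p a)" for y
      using imageI[OF departures_up[OF ascend(2,3) that], of "map Some"] by simp
    ultimately show ?thesis
      using ascend assms(1) sector_langsI(2)[OF step_closed[of p a]]
      unfolding factors_in_def
      by (intro exI[of _ "[Tm (Some a), Nt (map Some ` departures (step p a))]"]) auto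
  qed
qed

lemma factors_arrivals:
  assumes "q \<in> V" "w \<in> arrivals q"
  shows "sector_factors (map Some w) (map Some ` arrivals q)"
proof -
  obtain r where r: "r \<in> V" "w \<in> walks (level q) r q"
    using assms(2) unfolding arrivals_def by blast
  then show ?thesis
  proof (cases rule: walks_last)
    case stay
    then show ?thesis
      using assms(2) unfolding factors_in_def by (intro exI[of _ "[]"]) simp
  next
    case (hop H p h v)
    have p: "level q = level p" using hop(3) by (simp add: hop_def)
    have "sector_factors (map Some v @ map Some h) (map Some ` arrivals q)"
    proof (rule factors_hop_right[OF hop(3)])
      show "map Some ` arrivals p \<in> sector_langs" using hop(2) by (intro sector_langsI)
      show "map Some v \<in> map Some ` arrivals p" using hop(4) r(1) unfolding arrivals_def by blast
    next
      fix x y assume "x \<in> returns p q" "y \<in> map Some ` arrivals p"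
      then show "y @ map Some x \<in> map Some ` arrivals q"
        using arrivals_returns p by (auto simp flip: map_append)
    qed
    then show ?thesis using hop(1) by simp
  next
    case (descend a v p)
    have "v \<in> arrivals p" using descend(6) r(1) unfolding arrivals_def by blast
    moreover have "map Some y @ [Some a] \<in> map Some ` arrivals q" if "y \<in> arrivals p" for y
    proof (rule image_eqI)
      show "y @ [a] \<in> arrivals q"
        using that walks_down[OF descend(2,4,5)] unfolding arrivals_def by blast
    qed simp
    ultimately show ?thesis
      using descend sector_langsI(3)[OF descend(3)] unfolding factors_in_def
      by (intro exI[of _ "[Nt (map Some ` arrivals p), Tm (Some a)]"]) auto
  qed
qed

text \<open>
  As long as one of the two walks returns to the level of \<open>p\<close> and \<open>q\<close>, a hop is split off on its
  side. Otherwise each walk is empty or stays above the next level. If both are nonempty, their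
  outer letters are split off and separated states one level higher remain. If just one is empty, the
  end states are separated by their levels, so the other walk may be replaced by any walk that stays
  above the next level; if both are empty, \<open>p\<close> and \<open>q\<close> are themselves the separated states.
\<close>

lemma factors_separations:
  assumes "(p, q) \<in> level_pairs" "z \<in> separations p q"
  shows "sector_factors z (separations p q)"
proof -
  have pq: "p \<in> V" "q \<in> V" "level q = level p" using assms by (auto simp: level_pairs_def)
  obtain u v r where z: "z = mark u v" and u: "u \<in> departures p"
    and r: "r \<in> V" "v \<in> walks (level q) r q" "r \<noteq> run p u"
    using assms(2) unfolding separations_def by blast
  from u have u': "u \<in> walks (level p) p (run p u)" by (simp add: departures_def walks_def)
  consider (hop_left) H p' h x where "u = h @ x" "hop p H p' h" "x \<in> walks (level p') p' (run p u)"
    | (hop_right) H q' h y where "v = y @ h" "q' \<in> V" "hop q' H q h" "y \<in> walks (level q') r q'"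
    | (level) "u = []" "v = []" "r = q"
    | (left_up) a x where "v = []" "r = q" "u = a # x" "a \<in> A" "level (step p a) = Suc (level p)"
        "x \<in> walks (level (step p a)) (step p a) (run p u)"
    | (right_up) b y q' where "u = []" "v = y @ [b]" "b \<in> A" "q' \<in> V" "step q' b = q"
        "level q' = Suc (level q)" "y \<in> walks (level q') r q'"
    | (both_up) a x b y q' where "u = a # x" "a \<in> A" "level (step p a) = Suc (level p)"
        "x \<in> walks (level (step p a)) (step p a) (run p u)"
        "v = y @ [b]" "b \<in> A" "q' \<in> V" "step q' b = q"
        "level q' = Suc (level q)" "y \<in> walks (level q') r q'"
    by (cases rule: walks_head[OF pq(1) u']; cases rule: walks_last[OF r(1,2)]) metis+
  then show ?thesis
  proof cases
    case hop_left
    have p': "p' \<in> V" "level p' = level p" using hop_left(2) by (auto simp: hop_def)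
    have h: "run p h = p'"
    proof -
      have "map Some h \<in> conc (\<lambda>X. X) H"
        using hop_left(2) conc_mono[of "\<lambda>X. {v \<in> X. length v < length h}" "\<lambda>X. X" H]
        unfolding hop_def by blast
      then have "map Some h \<in> map Some ` returns p p'"
        using hop_left(2) unfolding hop_def by blast
      then show ?thesis by (auto simp: walks_def inj_map_eq_map)
    qed
    have "sector_factors (map Some h @ mark x v) (separations p q)"
    proof (rule factors_hop_left[OF hop_left(2)])
      show "separations p' q \<in> sector_langs" using p' pq by (intro sector_langsI) auto
      show "mark x v \<in> separations p' q"
        using hop_left(1,3) r h unfolding separations_def departures_run by auto
    qed (rule separations_left[OF _ p'(2)])
    then show ?thesis using hop_left(1) by (simp add: z mark_def)
  next
    case hop_right
    have q': "level q = level q'" using hop_right(3) by (simp add: hop_def)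
    have "sector_factors (mark u y @ map Some h) (separations p q)"
    proof (rule factors_hop_right[OF hop_right(3)])
      show "separations p q' \<in> sector_langs" using q' pq hop_right(2) by (intro sector_langsI) auto
      show "mark u y \<in> separations p q'"
        using hop_right(4) r u unfolding separations_def by blast
    qed (rule separations_right[OF pq(2) hop_right(2) _ q'])
    then show ?thesis using hop_right(1) by (simp add: z mark_def)
  next
    case level
    then have "z = [None]" by (simp add: z mark_def)
    then show ?thesis
      using assms(2) unfolding factors_in_def by (intro exI[of _ "[Tm None]"]) simp
  next
    case left_up
    have "x \<in> departures (step p a)" using left_up(6) unfolding departures_run by blast
    moreover have "Some a # map Some x' @ [None] \<in> separations p q"
      if x': "x' \<in> departures (step p a)" for x'
    proof -
      have "Suc (level p) \<le> level (run (step p a) x')"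
        using x' left_up(5) above_end by (auto simp: departures_def)
      then have "q \<noteq> run p (a # x')" using pq(3) by auto
      moreover have "a # x' \<in> departures p" using departures_up left_up(4,5) x' by blast
      moreover have "[] \<in> walks (level q) q q" by (simp add: walks_def)
      moreover have "Some a # map Some x' @ [None] = mark (a # x') []" by (simp add: mark_def)
      ultimately show ?thesis using pq(2) unfolding separations_def by blast
    qed
    ultimately show ?thesis
      using left_up sector_langsI(2)[OF step_closed[OF pq(1) left_up(4)]]
      unfolding factors_in_def z
      by (intro exI[of _ "[Tm (Some a), Nt (map Some ` departures (step p a)), Tm None]"])
        (auto simp: mark_def)
  next
    case right_up
    have "y \<in> arrivals q'" using right_up(7) r(1) unfolding arrivals_def by blast
    moreover have "None # map Some y' @ [Some b] \<in> separations p q" if y': "y' \<in> arrivals q'" for y'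
    proof -
      obtain r' where r': "r' \<in> V" "y' \<in> walks (level q') r' q'"
        using y' unfolding arrivals_def by blast
      then have "Suc (level q) \<le> level r'"
        using right_up(6) above_start by (auto simp: walks_def)
      then have "r' \<noteq> run p []" using pq(3) by auto
      moreover have "y' @ [b] \<in> walks (level q) r' q"
        using walks_down[OF right_up(3,5,6)] r' by blast
      moreover have "[] \<in> departures p" by (simp add: departures_def)
      moreover have "None # map Some y' @ [Some b] = mark [] (y' @ [b])" by (simp add: mark_def)
      ultimately show ?thesis using r'(1) unfolding separations_def by blast
    qed
    ultimately show ?thesis
      using right_up sector_langsI(3)[OF right_up(4)]
      unfolding factors_in_def z
      by (intro exI[of _ "[Tm None, Nt (map Some ` arrivals q'), Tm (Some b)]"])
        (auto simp: mark_def)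
  next
    case both_up
    have p': "step p a \<in> V" using step_closed[OF pq(1) both_up(2)] .
    have lev: "level q' = level (step p a)" using both_up(3,9) pq(3) by simp
    have "x \<in> departures (step p a)" using both_up(4) unfolding departures_run by blast
    then have "mark x y \<in> separations (step p a) q'"
      using r both_up(1,10) unfolding separations_def by auto
    moreover have "Some a # x' @ [Some b] \<in> separations p q"
      if x': "x' \<in> separations (step p a) q'" for x'
    proof -
      obtain s t r' where s: "x' = mark s t" "s \<in> departures (step p a)" "r' \<in> V"
        "t \<in> walks (level q') r' q'" "r' \<noteq> run (step p a) s"
        using x' unfolding separations_def by blast
      have "Some a # x' @ [Some b] = mark (a # s) (t @ [b])" by (simp add: s mark_def)
      moreover have "a # s \<in> departures p" using departures_up both_up(2,3) s(2) by blast
      moreover have "t @ [b] \<in> walks (level q) r' q"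
        using walks_down[OF both_up(6,8,9) s(4)] .
      moreover have "r' \<noteq> run p (a # s)" using s(5) by simp
      ultimately show ?thesis using s(3) unfolding separations_def by blast
    qed
    ultimately show ?thesis
      using both_up(2,6) sector_langsI(4)[OF p' both_up(7) lev]
      unfolding factors_in_def z both_up(1,5)
      by (intro exI[of _ "[Tm (Some a), Nt (separations (step p a) q'), Tm (Some b)]"])
        (auto simp: mark_def)
  qed
qed

lemma factors_sector_langs: "\<lbrakk>L \<in> sector_langs; z \<in> L\<rbrakk> \<Longrightarrow> sector_factors z L"
proof -
  assume "L \<in> sector_langs" "z \<in> L"
  then consider p q w where "(p, q) \<in> level_pairs" "w \<in> returns p q" "z = map Some w"
      "L = map Some ` returns p q"
    | p w where "p \<in> V" "w \<in> departures p" "z = map Some w" "L = map Some ` departures p"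
    | p w where "p \<in> V" "w \<in> arrivals p" "z = map Some w" "L = map Some ` arrivals p"
    | p q where "(p, q) \<in> level_pairs" "z \<in> separations p q" "L = separations p q"
    unfolding sector_langs_def return_langs_def separation_langs_def by blast
  then show ?thesis
    by cases (simp_all add: factors_returns factors_departures factors_arrivals factors_separations)
qed

lemma lowest_point:
  assumes "w \<in> lists A"
  obtains u v where "w = u @ v" "above (level (run p u)) p w"
proof -
  have "\<exists>u v. w = u @ v \<and> above (level (run p u)) p w"
    using assms
  proof (induction w arbitrary: p)
    case Nil
    then show ?case by simp
  next
    case (Cons a w)
    from Cons.IH[of "step p a"] obtain u v
      where uv: "w = u @ v" "above (level (run (step p a) u)) (step p a) w" by blast
    show ?case
    proof (cases "level (run (step p a) u) \<le> level p")
      case True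
      then show ?thesis using uv by (intro exI[of _ "a # u"] exI[of _ v]) simp
    next
      case False
      then have "above (level p) p (a # w)" using above_mono[OF uv(2)] by simp
      then have "a # w = [] @ a # w \<and> above (level (run p [])) p (a # w)" by simp
      then show ?thesis by blast
    qed
  qed
  then show ?thesis using that by blast
qed

text \<open>
  If \<open>w\<close> moves \<open>r\<close>, cut its walk at a state \<open>p\<close> of least level. The two parts arrive at and depart
  from \<open>p\<close> above the level of \<open>p\<close>, and they witness a separation at \<open>p\<close> once they are read in the
  opposite order, from \<open>p\<close> outwards.
\<close>

lemma moved_words_eq:
  "{w \<in> lists A. \<exists>r\<in>V. run r w \<noteq> r} = {v @ u | u v. mark u v \<in> (\<Union>p\<in>V. separations p p)}"
proof (intro equalityI subsetI)
  fix w assume "w \<in> {w \<in> lists A. \<exists>r\<in>V. run r w \<noteq> r}"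
  then obtain r where w: "w \<in> lists A" and r: "r \<in> V" "run r w \<noteq> r" by blast
  from lowest_point[OF w] obtain v u where vu: "w = v @ u" "above (level (run r v)) r w" .
  let ?p = "run r v"
  have "?p \<in> V" using run_closed r(1) w vu(1) by simp
  moreover have "mark u v \<in> separations ?p ?p"
    using r vu w unfolding separations_def
    by (force simp: departures_def walks_def above_append)
  ultimately show "w \<in> {v @ u | u v. mark u v \<in> (\<Union>p\<in>V. separations p p)}"
    using vu(1) by blast
next
  fix w assume "w \<in> {v @ u | u v. mark u v \<in> (\<Union>p\<in>V. separations p p)}"
  then obtain u v p u' v' r where w: "w = v @ u" and "mark u v = mark u' v'" "p \<in> V"
    "u' \<in> departures p" "r \<in> V" "v' \<in> walks (level p) r p" "r \<noteq> run p u'"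
    unfolding separations_def by blast
  moreover from this have "u' = u" "v' = v" by (auto simp: mark_inject)
  ultimately have "w \<in> lists A" "r \<in> V" "run r w \<noteq> r"
    by (auto simp: departures_def walks_def)
  then show "w \<in> {w \<in> lists A. \<exists>r\<in>V. run r w \<noteq> r}" by blast
qed

text \<open>
  The family is kept in the conclusion, and not only that the moved words form a context-free
  language, so that the families of several graphs can be united into a single grammar.
\<close>

theorem moved_words_factors:
  assumes "context_free {w \<in> lists A. run x0 w = x0}"
  shows "\<exists>\<L> \<S>. finite \<L> \<and> \<S> \<subseteq> \<L> \<and>
    (\<forall>L\<in>\<L>. \<forall>z\<in>L. factors_in (insert None (Some ` A)) 4 \<L> z L) \<and>
    {w \<in> lists A. \<exists>r\<in>V. run r w \<noteq> r} = {v @ u | u v. mark u v \<in> \<Union>\<S>}"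
proof (intro exI conjI)
  show "finite sector_langs" unfolding sector_langs_def using finite_langs[OF assms] by simp
  show "(\<lambda>p. separations p p) ` V \<subseteq> sector_langs" using sector_langsI(4) by blast
  show "\<forall>L\<in>sector_langs. \<forall>z\<in>L. sector_factors z L" using factors_sector_langs by blast
qed (rule moved_words_eq)

end

section \<open>The word problem of the transition group\<close>

locale complete_A_graph = A_graph A ainv \<Gamma>
  for A :: "'a set" and ainv :: "'a \<Rightarrow> 'a" and \<Gamma> :: "('v, 'e, 'a) labeled_digraph" +
  assumes complete: "complete_graph A \<Gamma>"
begin

definition successor :: "'v \<Rightarrow> 'a \<Rightarrow> 'v" where
  "successor p a = head (dgraph \<Gamma>)
    (THE e. e \<in> arcs (dgraph \<Gamma>) \<and> tail (dgraph \<Gamma>) e = p \<and> label \<Gamma> e = a)"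

lemma successor_arc: "e \<in> arcs (dgraph \<Gamma>) \<Longrightarrow>
  successor (tail (dgraph \<Gamma>) e) (label \<Gamma> e) = head (dgraph \<Gamma>) e"
  unfolding successor_def using deterministic
  by (intro arg_cong[where f = "head (dgraph \<Gamma>)"] the_equality) auto

lemma ex_arc:
  assumes "p \<in> verts (dgraph \<Gamma>)" "a \<in> A"
  obtains e where "e \<in> arcs (dgraph \<Gamma>)" "tail (dgraph \<Gamma>) e = p" "label \<Gamma> e = a"
    "successor p a = head (dgraph \<Gamma>) e"
  using assms complete successor_arc unfolding complete_graph_def by metis

lemma awalk_successor:
  "awalk p es q \<Longrightarrow> map (label \<Gamma>) es \<in> lists A \<and> foldl successor p (map (label \<Gamma>) es) = q"
proof (induction es arbitrary: p)
  case Nil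
  then show ?case by (simp add: awalk_Nil_iff)
next
  case (Cons e es)
  then show ?case using label_closed[of e] successor_arc[of e] by (auto simp: awalk_Cons_iff)
qed

lemma circuit_lang_successor:
  assumes "p \<in> verts (dgraph \<Gamma>)"
  shows "circuit_lang \<Gamma> p = {w \<in> lists A. foldl successor p w = p}"
proof (intro equalityI subsetI)
  fix w assume "w \<in> circuit_lang \<Gamma> p"
  then show "w \<in> {w \<in> lists A. foldl successor p w = p}"
    using awalk_successor unfolding circuit_lang_def by blast
next
  fix w assume w: "w \<in> {w \<in> lists A. foldl successor p w = p}"
  then obtain es q where "awalk p es q" "map (label \<Gamma>) es = w"
    using complete_walk[OF complete _ assms] by blast
  moreover from this have "q = p" using w awalk_successor by blast
  ultimately show "w \<in> circuit_lang \<Gamma> p" unfolding circuit_lang_def by blast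
qed

lemma permutation_automaton:
  assumes "x0 \<in> verts (dgraph \<Gamma>)"
  shows "permutation_automaton A ainv (verts (dgraph \<Gamma>)) successor x0"
proof
  fix p a assume p: "p \<in> verts (dgraph \<Gamma>)" and a: "a \<in> A"
  from ex_arc[OF p a] obtain e where e: "e \<in> arcs (dgraph \<Gamma>)" "tail (dgraph \<Gamma>) e = p"
    "label \<Gamma> e = a" "successor p a = head (dgraph \<Gamma>) e" .
  then show "successor p a \<in> verts (dgraph \<Gamma>)" by simp
  show "successor (successor p a) (ainv a) = p"
    using successor_arc[of "einv \<Gamma> e"] e by (simp add: label_einv)
next
  fix p assume p: "p \<in> verts (dgraph \<Gamma>)"
  have "symmetric (dgraph \<Gamma>)"
    unfolding symmetric_def sym_def
  proof (intro allI impI)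
    fix u v assume "(u, v) \<in> arcs_ends (dgraph \<Gamma>)"
    then obtain e where "e \<in> arcs (dgraph \<Gamma>)" "tail (dgraph \<Gamma>) e = u" "head (dgraph \<Gamma>) e = v"
      by (auto simp: arcs_ends_def arc_to_ends_def)
    then show "(v, u) \<in> arcs_ends (dgraph \<Gamma>)"
      unfolding arcs_ends_def arc_to_ends_def by (intro image_eqI[of _ _ "einv \<Gamma> e"]) auto
  qed
  from symmetric_connected_imp_strongly_connected[OF this connected_graph]
  have "x0 \<rightarrow>\<^sup>*\<^bsub>dgraph \<Gamma>\<^esub> p" using assms p by auto
  then obtain es where "awalk x0 es p" unfolding reachable_awalk by blast
  then show "\<exists>w\<in>lists A. foldl successor x0 w = p" using awalk_successor by blast
qed (fact assms)

lemma foldl_successor_reduce: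
  assumes "w \<in> lists A" "p \<in> verts (dgraph \<Gamma>)"
  shows "foldl successor p (reduce ainv w) = foldl successor p w"
proof -
  interpret permutation_automaton A ainv "verts (dgraph \<Gamma>)" successor p
    by (rule permutation_automaton[OF assms(2)])
  have cons: "foldl successor q (reduce_Cons ainv a v) = foldl successor q (a # v)"
    if "q \<in> verts (dgraph \<Gamma>)" "a \<in> A" for q a v
    using that step_ainv[of q a] by (auto simp: reduce_Cons_def split: list.splits)
  have "foldl successor q (reduce ainv w) = foldl successor q w" if "q \<in> verts (dgraph \<Gamma>)" for q
    using assms(1) that
    by (induction w arbitrary: q) (auto simp: cons step_closed)
  then show ?thesis using assms(2) .
qed

lemma moved_words:
  assumes "w \<in> lists A"
  shows "w \<notin> common_circuit_lang \<Gamma> \<longleftrightarrow> (\<exists>p\<in>verts (dgraph \<Gamma>). foldl successor p w \<noteq> p)"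
  using assms circuit_lang_successor unfolding common_circuit_lang_def by auto

lemma common_circuit_lang_reduce:
  assumes "w \<in> lists A"
  shows "reduce ainv w \<in> common_circuit_lang \<Gamma> \<longleftrightarrow> w \<in> common_circuit_lang \<Gamma>"
  using moved_words[OF assms] moved_words[OF reduce_lists[OF assms, of ainv]]
    foldl_successor_reduce[OF assms] by auto

lemma moved_words_factors:
  assumes "context_free_graph \<Gamma>"
  shows "\<exists>\<L> \<S>. finite \<L> \<and> \<S> \<subseteq> \<L> \<and>
    (\<forall>L\<in>\<L>. \<forall>z\<in>L. factors_in (insert None (Some ` A)) 4 \<L> z L) \<and>
    lists A - common_circuit_lang \<Gamma> = {v @ u | u v. mark u v \<in> \<Union>\<S>}"
proof -
  obtain x0 where x0: "x0 \<in> verts (dgraph \<Gamma>)" "context_free (circuit_lang \<Gamma> x0)"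
    using assms unfolding context_free_graph_def by blast
  interpret permutation_automaton A ainv "verts (dgraph \<Gamma>)" successor x0
    by (rule permutation_automaton[OF x0(1)])
  have moved: "lists A - common_circuit_lang \<Gamma> =
      {w \<in> lists A. \<exists>r\<in>verts (dgraph \<Gamma>). run r w \<noteq> r}"
    using moved_words by blast
  show ?thesis
    unfolding moved
    by (rule moved_words_factors[OF x0(2)[unfolded circuit_lang_successor[OF x0(1)]]])
qed

end

lemma word_value_transition_group:
  assumes "involutive_alphabet A ainv" "transition_kernel A ainv I \<Gamma> \<lhd> free_group A ainv"
    and "w \<in> lists A"
  shows "word_value (transition_group A ainv I \<Gamma>) (transition_letter A ainv I \<Gamma>) w
    = transition_kernel A ainv I \<Gamma> #>\<^bsub>free_group A ainv\<^esub> reduce ainv w"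
proof -
  interpret involutive_alphabet A ainv by fact
  let ?F = "free_group A ainv" and ?K = "transition_kernel A ainv I \<Gamma>"
  interpret normal ?K ?F by fact
  have carrier: "reduce ainv v \<in> carrier ?F" if "v \<in> lists A" for v
    using reduce_lists[OF that] reduced_reduce by (simp add: free_group_def del: in_lists_conv_set)
  show ?thesis
    using assms(3)
  proof (induction w)
    case Nil
    have "reduce ainv [] = \<one>\<^bsub>?F\<^esub>" by (simp add: free_group_def)
    then show ?case
      using coset_mult_one[OF subset] by (simp add: word_value_def transition_group_def FactGroup_def)
  next
    case (Cons a w)
    note a = Cons.hyps(1) and w = Cons.hyps(2)
    have "[a] \<in> carrier ?F" using a by (simp add: free_group_def reduced_Cons)
    moreover have "[a] \<otimes>\<^bsub>?F\<^esub> reduce ainv w = reduce ainv (a # w)"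
      using reduce_append_right[of "[a]" w] by (simp add: free_group_def)
    ultimately have "(?K #>\<^bsub>?F\<^esub> [a]) <#>\<^bsub>?F\<^esub> (?K #>\<^bsub>?F\<^esub> reduce ainv w)
        = ?K #>\<^bsub>?F\<^esub> reduce ainv (a # w)"
      using rcos_sum carrier[OF w] by simp
    with Cons.IH show ?case
      by (simp add: word_value_def transition_letter_def transition_group_def FactGroup_def)
  qed
qed

text \<open>
  The kernel consists of reduced words, but free reduction does not change how a word acts on the
  vertices. So no reduction appears in the word problem.
\<close>

lemma word_problem_transition_group:
  assumes alph: "involutive_alphabet A ainv"
    and graphs: "\<And>i. i \<in> I \<Longrightarrow> A_graph A ainv (\<Gamma> i)"
    and complete: "\<And>i. i \<in> I \<Longrightarrow> complete_graph A (\<Gamma> i)"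
  shows "word_problem A (transition_group A ainv I \<Gamma>) (transition_letter A ainv I \<Gamma>)
    = lists A \<inter> (\<Inter>i\<in>I. common_circuit_lang (\<Gamma> i))"
proof -
  interpret involutive_alphabet A ainv by fact
  let ?F = "free_group A ainv" and ?K = "transition_kernel A ainv I \<Gamma>"
  have K: "?K \<lhd> ?F" using normal_transition_kernel[OF alph graphs complete] .
  interpret normal ?K ?F by fact
  have "word_value (transition_group A ainv I \<Gamma>) (transition_letter A ainv I \<Gamma>) w
      = \<one>\<^bsub>transition_group A ainv I \<Gamma>\<^esub> \<longleftrightarrow> w \<in> (\<Inter>i\<in>I. common_circuit_lang (\<Gamma> i))"
    if w: "w \<in> lists A" for w
  proof -
    have red: "reduce ainv v \<in> common_circuit_lang (\<Gamma> i) \<longleftrightarrow> v \<in> common_circuit_lang (\<Gamma> i)"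
      if "i \<in> I" "v \<in> lists A" for i v
    proof -
      interpret complete_A_graph A ainv "\<Gamma> i"
        using graphs[OF that(1)] complete[OF that(1)]
        by (simp add: complete_A_graph_def complete_A_graph_axioms_def)
      show ?thesis by (rule common_circuit_lang_reduce[OF that(2)])
    qed
    have carrier: "reduce ainv w \<in> carrier ?F"
      using reduce_lists[OF w] reduced_reduce by (simp add: free_group_def del: in_lists_conv_set)
    have "word_value (transition_group A ainv I \<Gamma>) (transition_letter A ainv I \<Gamma>) w
        = \<one>\<^bsub>transition_group A ainv I \<Gamma>\<^esub> \<longleftrightarrow> ?K #>\<^bsub>?F\<^esub> reduce ainv w = ?K"
      using word_value_transition_group[OF alph K w] by (simp add: transition_group_def FactGroup_def)
    also have "\<dots> \<longleftrightarrow> reduce ainv w \<in> ?K"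
      using coset_join1[OF _ carrier] coset_join2[OF carrier] subgroup_axioms subset by blast
    also have "\<dots> \<longleftrightarrow> w \<in> (\<Inter>i\<in>I. common_circuit_lang (\<Gamma> i))"
    proof
      assume "reduce ainv w \<in> ?K"
      then obtain v where "reduce ainv w = reduce ainv v" "v \<in> lists A"
        "v \<in> (\<Inter>i\<in>I. common_circuit_lang (\<Gamma> i))"
        unfolding transition_kernel_def by blast
      then show "w \<in> (\<Inter>i\<in>I. common_circuit_lang (\<Gamma> i))"
        using red[OF _ w] red[OF _ \<open>v \<in> lists A\<close>] by simp
    next
      assume "w \<in> (\<Inter>i\<in>I. common_circuit_lang (\<Gamma> i))"
      then show "reduce ainv w \<in> ?K" using w unfolding transition_kernel_def by blast
    qed
    finally show ?thesis .
  qed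
  then show ?thesis unfolding word_problem_def by blast
qed

theorem theorem4p11:
  fixes A :: "'a set" and ainv :: "'a \<Rightarrow> 'a"
    and k :: nat and \<Gamma> :: "nat \<Rightarrow> ('v, 'e, 'a) labeled_digraph"
  assumes "involutive_alphabet A ainv"
    and "\<And>i. i \<in> {1..k} \<Longrightarrow> A_graph A ainv (\<Gamma> i)"
    and "\<And>i. i \<in> {1..k} \<Longrightarrow> complete_graph A (\<Gamma> i)"
    and "\<And>i. i \<in> {1..k} \<Longrightarrow> context_free_graph (\<Gamma> i)"
  shows "co_context_free A (transition_group A ainv {1..k} \<Gamma>)
           (transition_letter A ainv {1..k} \<Gamma>)"
proof -
  interpret involutive_alphabet A ainv by fact
  let ?T = "insert None (Some ` A)"
  have word_problem: "word_problem A (transition_group A ainv {1..k} \<Gamma>)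
      (transition_letter A ainv {1..k} \<Gamma>) = lists A \<inter> (\<Inter>i\<in>{1..k}. common_circuit_lang (\<Gamma> i))"
    using assms(1-3) by (rule word_problem_transition_group)
  define good where "good i \<L> \<S> \<longleftrightarrow> finite \<L> \<and> \<S> \<subseteq> \<L> \<and>
      (\<forall>L\<in>\<L>. \<forall>z\<in>L. factors_in ?T 4 \<L> z L) \<and>
      lists A - common_circuit_lang (\<Gamma> i) = {v @ u | u v. mark u v \<in> \<Union>\<S>}" for i \<L> \<S>
  have "\<exists>\<L> \<S>. good i \<L> \<S>" if i: "i \<in> {1..k}" for i
  proof -
    interpret complete_A_graph A ainv "\<Gamma> i"
      using assms(2,3)[OF i] by (simp add: complete_A_graph_def complete_A_graph_axioms_def)
    show ?thesis unfolding good_def by (rule moved_words_factors[OF assms(4)[OF i]])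
  qed
  then obtain \<L> \<S> where good: "\<And>i. i \<in> {1..k} \<Longrightarrow> good i (\<L> i) (\<S> i)" by metis
  have fin: "finite (\<L> i)" and sub: "\<S> i \<subseteq> \<L> i"
    and moved: "lists A - common_circuit_lang (\<Gamma> i) = {v @ u | u v. mark u v \<in> \<Union>(\<S> i)}"
    if "i \<in> {1..k}" for i
    using good[OF that] unfolding good_def by blast+
  have factors: "factors_in ?T 4 (\<L> i) z L" if "i \<in> {1..k}" "L \<in> \<L> i" "z \<in> L" for i L z
    using good[OF that(1)] that(2,3) unfolding good_def by blast
  define K where "K = \<Union>(\<Union>i\<in>{1..k}. \<S> i)"
  \<comment> \<open>the words of \<open>K\<close> are factored as words of the member of \<open>\<S> i\<close> they come from\<close>
  define \<M> where "\<M> = insert K (\<Union>i\<in>{1..k}. \<L> i)"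
  have "context_free K"
  proof (rule context_free_if_factors_in)
    show "finite ?T" using finite_alphabet by simp
    show "finite \<M>" unfolding \<M>_def using fin by simp
    show "K \<in> \<M>" by (simp add: \<M>_def)
    have in_\<L>: "factors_in ?T 4 \<M> z L" if "i \<in> {1..k}" "L \<in> \<L> i" "z \<in> L" for i L z
    proof -
      have "\<L> i \<subseteq> \<M>" using that(1) unfolding \<M>_def by blast
      then show ?thesis using factors_in_mono[OF factors[OF that]] by blast
    qed
    fix L z assume "L \<in> \<M>" "z \<in> L"
    then consider i where "i \<in> {1..k}" "L \<in> \<L> i" | "L = K" unfolding \<M>_def by blast
    then show "factors_in ?T 4 \<M> z L"
    proof cases
      case 1
      then show ?thesis using in_\<L> \<open>z \<in> L\<close> by blast
    next
      case 2
      then obtain i L' where L': "i \<in> {1..k}" "L' \<in> \<S> i" "z \<in> L'"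
        using \<open>z \<in> L\<close> unfolding K_def by blast
      then have "L' \<subseteq> L" unfolding 2 K_def by blast
      with L' show ?thesis using in_\<L>[OF L'(1) _ L'(3)] sub factors_in_mono by blast
    qed
  qed
  then have "context_free {v @ u | u v. mark u v \<in> K}" by (rule context_free_inside_out)
  also have "{v @ u | u v. mark u v \<in> K} = (\<Union>i\<in>{1..k}. {v @ u | u v. mark u v \<in> \<Union>(\<S> i)})"
    by (auto simp only: K_def)
  also have "\<dots> = (\<Union>i\<in>{1..k}. lists A - common_circuit_lang (\<Gamma> i))"
    by (rule SUP_cong[OF refl]) (rule moved[symmetric])
  also have "\<dots> = lists A - word_problem A (transition_group A ainv {1..k} \<Gamma>)
      (transition_letter A ainv {1..k} \<Gamma>)"
    unfolding word_problem by blast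
  finally show ?thesis unfolding co_context_free_def .
qed

end
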